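(* In the variable-assignment setting, suppose that $\mathcal B$ satisfies Shearer's criterion. Let $i\in\{1,\dots,n\}$, let $D$ be a set of possible values of the variable $X(i)$, and let $A$ be the event $X(i)\in D$ (so $\mathrm{var}(A)=\{i\}$). Let $\mathcal B'$ be the set of bad-events $B\in\mathcal B[A]$ with $i\in\mathrm{var}(B)$, enumerated in an arbitrary order as $\mathcal B'=\{B_1,\dots,B_m\}$. Then $$\Pr_{\mathrm{MT}}(A)\ \le\ \Pr_\Omega(A)\Bigl(1+\sum_{j=1}^m\Pr_\Omega\bigl(B_j\wedge\neg B_1\wedge\dots\wedge\neg B_{j-1}\bigr)\,\Psi_{\mathcal B[A]}(B_j)\Bigr).$$
   Context: Variable-assignment setting: $\Omega$ is a product probability space with independent random variables $X(1),\dots,X(n)$. Every event $E$ considered is a boolean function of the variables in a specified subset $\mathrm{var}(E)\subseteq\{1,\dots,n\}$, and $E\sim E'$ means $\mathrm{var}(E)\cap\mathrm{var}(E')\ne\emptyset$. $\mathcal B$ is a finite collection of events (the bad-events). For an event $E$, $N(E)=\{B\in\mathcal B: B\sim E\}$ (for $B\in\mathcal B$ this is the inclusive neighborhood, so $B\in N(B)$). A set $I\subseteq\mathcal B$ is stable if no two distinct $B,B'\in I$ satisfy $B\sim B'$. For a subfamily $\mathcal C\subseteq\mathcal B$ and $I\subseteq\mathcal C$ let $$Q_{\mathcal C}(I)=\sum_{I\subseteq J\subseteq\mathcal C,\ J\text{ stable}}(-1)^{|J|-|I|}\prod_{B\in J}\Pr_\Omega(B).$$ Shearer's criterion for $\mathcal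 B$: $Q_{\mathcal B}(I)>0$ for all stable $I\subseteq\mathcal B$. (It is then also satisfied by every subfamily.) Under it, $\mu_{\mathcal C}(I)=Q_{\mathcal C}(I)/Q_{\mathcal C}(\emptyset)$ and, for an event $E$, $\Psi_{\mathcal C}(E)=\sum_{J\subseteq N(E)\cap\mathcal C}\mu_{\mathcal C}(J)$. For an event $E$, $\mathcal B[E]$ is the set of $B\in\mathcal B$ with $\Pr_\Omega(E\mid B)<1$. MT (Moser–Tardos) algorithm: draw $X\sim\Omega$; while some $B\in\mathcal B$ is true on $X$, choose some true $B\in\mathcal B$ (by an arbitrary fixed, possibly randomized, rule) and resample all variables in $\mathrm{var}(B)$ independently from their distributions in $\Omega$. Under Shearer's criterion it terminates with probability one. $\Pr_{\mathrm{MT}}$ denotes probability with respect to the distribution of $X$ at termination; the result holds for every choice of selection rule. *)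

theory Defs
  imports "HOL-Probability.Probability"
begin

text \<open>
  An event is a set of assignments together with the set of variables on which it is declared
  to depend. That the first component really is a measurable function of the variables in the
  second one is expressed by \<open>is_event\<close>.
\<close>

datatype 'a event = Event (holds: "(nat \<Rightarrow> 'a) set") (var: "nat set")

text \<open>The variable \<open>X(k)\<close> is the \<open>k\<close>-th coordinate and has distribution \<open>M k\<close>.\<close>

definition assignments :: "nat \<Rightarrow> (nat \<Rightarrow> 'a measure) \<Rightarrow> (nat \<Rightarrow> 'a) measure" where
  "assignments n M = PiM {1..n} M"

definition is_event :: "nat \<Rightarrow> (nat \<Rightarrow> 'a measure) \<Rightarrow> 'a event \<Rightarrow> bool" where
  "is_event n M E \<longleftrightarrow>
     holds E \<in> sets (assignments n M) \<and> var E \<subseteq> {1..n} \<and>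
     (\<forall>x\<in>space (assignments n M). \<forall>y\<in>space (assignments n M).
        (\<forall>k\<in>var E. x k = y k) \<longrightarrow> (x \<in> holds E \<longleftrightarrow> y \<in> holds E))"

definition dependent_events :: "'a event \<Rightarrow> 'a event \<Rightarrow> bool" where
  "dependent_events E E' \<longleftrightarrow> var E \<inter> var E' \<noteq> {}"

definition nbhd :: "'a event set \<Rightarrow> 'a event \<Rightarrow> 'a event set" where
  "nbhd \<B> E = {B \<in> \<B>. dependent_events B E}"

definition stable :: "'a event set \<Rightarrow> bool" where
  "stable I \<longleftrightarrow> pairwise (\<lambda>B B'. \<not> dependent_events B B') I"

definition shearer_Q ::
  "(nat \<Rightarrow> 'a) measure \<Rightarrow> 'a event set \<Rightarrow> 'a event set \<Rightarrow> real" where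
  "shearer_Q \<Omega> \<C> I =
     (\<Sum>J | I \<subseteq> J \<and> J \<subseteq> \<C> \<and> stable J.
        (-1) ^ (card J - card I) * (\<Prod>B\<in>J. measure \<Omega> (holds B)))"

definition shearer_criterion :: "(nat \<Rightarrow> 'a) measure \<Rightarrow> 'a event set \<Rightarrow> bool" where
  "shearer_criterion \<Omega> \<B> \<longleftrightarrow> (\<forall>I. I \<subseteq> \<B> \<and> stable I \<longrightarrow> shearer_Q \<Omega> \<B> I > 0)"

definition shearer_mu ::
  "(nat \<Rightarrow> 'a) measure \<Rightarrow> 'a event set \<Rightarrow> 'a event set \<Rightarrow> real" where
  "shearer_mu \<Omega> \<C> I = shearer_Q \<Omega> \<C> I / shearer_Q \<Omega> \<C> {}"

text \<open>For \<open>\<C> \<subseteq> \<B>\<close>, \<open>nbhd \<C> E\<close> is \<open>N(E) \<inter> \<C>\<close>.\<close>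

definition shearer_Psi :: "(nat \<Rightarrow> 'a) measure \<Rightarrow> 'a event set \<Rightarrow> 'a event \<Rightarrow> real" where
  "shearer_Psi \<Omega> \<C> E = (\<Sum>J | J \<subseteq> nbhd \<C> E. shearer_mu \<Omega> \<C> J)"

text \<open>\<open>\<B>[E]\<close>\<close>

definition relevant_to ::
  "(nat \<Rightarrow> 'a) measure \<Rightarrow> 'a event set \<Rightarrow> 'a event \<Rightarrow> 'a event set" where
  "relevant_to \<Omega> \<B> E =
     {B \<in> \<B>. \<P>(x in \<Omega>. x \<in> holds E \<bar> x \<in> holds B) < 1}"

text \<open>
  A randomized selection rule reads a random seed, drawn from an arbitrary probability space
  \<open>R\<close> independently of the variables, and the list of all assignments seen so far, the current
  one last. As \<open>R\<close> is arbitrary, this covers deterministic and randomized rules, memoryless or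
  dependent on the whole history, but not rules that look at future samples. (The earlier
  selections need not be passed to the rule: they are determined by the seed and the earlier
  assignments.) The rule is only constrained on histories whose last assignment makes some
  bad-event true.
\<close>

definition selection_rule ::
  "(nat \<Rightarrow> 'a) measure \<Rightarrow> 'a event set \<Rightarrow> 'r measure
    \<Rightarrow> ('r \<Rightarrow> (nat \<Rightarrow> 'a) list \<Rightarrow> 'a event) \<Rightarrow> bool" where
  "selection_rule \<Omega> \<B> R sel \<longleftrightarrow>
     (\<forall>r\<in>space R. \<forall>h. h \<noteq> [] \<and> set h \<subseteq> space \<Omega> \<and> (\<exists>B\<in>\<B>. last h \<in> holds B) \<longrightarrow>
        sel r h \<in> \<B> \<and> last h \<in> holds (sel r h)) \<and>
     (\<forall>t. (\<lambda>(r, x). sel r (map x [0..<Suc t]))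
        \<in> R \<Otimes>\<^sub>M PiM {..t} (\<lambda>_. \<Omega>) \<rightarrow>\<^sub>M count_space UNIV)"

text \<open>
  The list of assignments after at most \<open>t\<close> resampling steps of the Moser-Tardos algorithm.
  The samples \<open>y 0, y 1, \<dots>\<close> are independent draws from \<open>\<Omega>\<close>: \<open>y 0\<close> is the initial assignment, and
  step \<open>t + 1\<close> takes the new values of the resampled variables from \<open>y (t + 1)\<close>. Once no
  bad-event is true the list no longer changes.
\<close>

primrec mt_history ::
  "'a event set \<Rightarrow> ('r \<Rightarrow> (nat \<Rightarrow> 'a) list \<Rightarrow> 'a event) \<Rightarrow> 'r \<Rightarrow> (nat \<Rightarrow> nat \<Rightarrow> 'a)
    \<Rightarrow> nat \<Rightarrow> (nat \<Rightarrow> 'a) list" where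
  "mt_history \<B> sel r y 0 = [y 0]"
| "mt_history \<B> sel r y (Suc t) =
     (let h = mt_history \<B> sel r y t in
      if \<exists>B\<in>\<B>. last h \<in> holds B
      then h @ [override_on (last h) (y (Suc t)) (var (sel r h))]
      else h)"

definition mt_state ::
  "'a event set \<Rightarrow> ('r \<Rightarrow> (nat \<Rightarrow> 'a) list \<Rightarrow> 'a event) \<Rightarrow> 'r \<Rightarrow> (nat \<Rightarrow> nat \<Rightarrow> 'a)
    \<Rightarrow> nat \<Rightarrow> nat \<Rightarrow> 'a" where
  "mt_state \<B> sel r y t = last (mt_history \<B> sel r y t)"

text \<open>
  The probability that the algorithm terminates with \<open>A\<close> true. The state is constant after
  termination, so the choice of the time \<open>t\<close> does not matter.
\<close>

definition mt_prob ::
  "(nat \<Rightarrow> 'a) measure \<Rightarrow> 'a event set \<Rightarrow> 'r measure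
    \<Rightarrow> ('r \<Rightarrow> (nat \<Rightarrow> 'a) list \<Rightarrow> 'a event) \<Rightarrow> 'a event \<Rightarrow> real" where
  "mt_prob \<Omega> \<B> R sel A =
     \<P>((r, y) in R \<Otimes>\<^sub>M PiM UNIV (\<lambda>_. \<Omega>).
        \<exists>t. (\<forall>B\<in>\<B>. mt_state \<B> sel r y t \<notin> holds B) \<and> mt_state \<B> sel r y t \<in> holds A)"

end

theory Submission
  imports Defs
begin

text \<open>
  Replace the samples of the algorithm by a resampling table: an independent copy \<open>T (k, p)\<close> of
  \<open>X(k)\<close> for every \<open>p\<close>, the \<open>p\<close>-th resampling of \<open>k\<close> reading entry \<open>p\<close>. This does not change the law
  of the final state, and all estimates below concern the table only.

  If \<open>A\<close> is true at the end but not at the start, look at the resampling that first makes it true.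
  Almost surely only events of \<open>\<B>[A]\<close> were resampled up to then, since any other bad-event is almost
  never true together with \<open>\<not> A\<close>; the last of them is some \<open>B\<^sub>j\<close>, and the table entry of \<open>i\<close> that
  follows lies in \<open>D\<close>. Arrange the ancestors of this resampling in layers: stable sets
  \<open>J\<^sub>1, J\<^sub>2, \<dots>\<close> with \<open>J\<^sub>1 \<subseteq> N(B\<^sub>j)\<close> and \<open>J\<^sub>s\<^sub>+\<^sub>1 \<subseteq> N(J\<^sub>s)\<close>. The values in the table just after these
  layers are a fresh sample of \<open>\<Omega>\<close>, on which \<open>B\<^sub>j\<close> holds. If \<open>B\<^sub>k\<close> with \<open>k < j\<close> also holds there, pass to
  the ancestors of \<open>B\<^sub>k\<close>; as \<open>i\<close> belongs to \<open>var B\<^sub>k\<close>, the position of the entry of \<open>i\<close> does not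
  change, so for the least possible \<open>j\<close> the event \<open>B\<^sub>j \<and> \<not> B\<^sub>1 \<and> \<dots> \<and> \<not> B\<^sub>j\<^sub>-\<^sub>1\<close> holds. For fixed layers these
  requirements are independent, and the total weight of the layer sequences below \<open>B\<^sub>j\<close> is at most
  \<open>\<Psi>(B\<^sub>j)\<close> because \<open>\<mu>(J)\<close> equals \<open>\<Prod>\<^sub>B\<^sub>\<in>\<^sub>J Pr(B)\<close> times the sum of \<open>\<mu>(K)\<close> over \<open>K \<subseteq> J \<union> N(J)\<close>.
\<close>

section \<open>Shearer sums\<close>

lemma shearer_Q_unstable:
  assumes "\<not> stable I" shows "shearer_Q \<Omega> \<C> I = 0"
proof -
  have "{J. I \<subseteq> J \<and> J \<subseteq> \<C> \<and> stable J} = {}"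
    using assms by (auto simp: stable_def intro: pairwise_subset)
  then show ?thesis unfolding shearer_Q_def by (simp only: sum.empty)
qed

lemma shearer_Q_not_subset:
  assumes "\<not> I \<subseteq> \<C>" shows "shearer_Q \<Omega> \<C> I = 0"
proof -
  have "{J. I \<subseteq> J \<and> J \<subseteq> \<C> \<and> stable J} = {}" using assms by auto
  then show ?thesis unfolding shearer_Q_def by (simp only: sum.empty)
qed

text \<open>Stable supersets of \<open>I\<close> that contain \<open>B\<close> occur in both terms
  on the right with opposite signs and cancel; those avoiding \<open>B\<close> remain.\<close>

lemma shearer_Q_remove_one:
  assumes "finite \<C>" "B \<in> \<C>" "B \<notin> I"
  shows "shearer_Q \<Omega> (\<C> - {B}) I = shearer_Q \<Omega> \<C> I + shearer_Q \<Omega> \<C> (insert B I)"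
proof (cases "I \<subseteq> \<C>")
  case True
  let ?f = "\<lambda>m J. (-1) ^ (card J - m) * (\<Prod>B\<in>J. measure \<Omega> (holds B))"
  let ?A = "{J. I \<subseteq> J \<and> J \<subseteq> \<C> - {B} \<and> stable J}"
  let ?B = "{J. insert B I \<subseteq> J \<and> J \<subseteq> \<C> \<and> stable J}"
  have fin: "finite {J. J \<subseteq> \<C>}" using assms by simp
  have split: "{J. I \<subseteq> J \<and> J \<subseteq> \<C> \<and> stable J} = ?A \<union> ?B" using assms(2) by auto
  have "shearer_Q \<Omega> \<C> I = sum (?f (card I)) ?A + sum (?f (card I)) ?B"
    unfolding shearer_Q_def split
    by (rule sum.union_disjoint) (auto intro: finite_subset[OF _ fin])
  moreover have "sum (?f (card I)) ?B = - sum (?f (card (insert B I))) ?B"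
    unfolding sum_negf[symmetric]
  proof (rule sum.cong[OF refl])
    fix J assume J: "J \<in> ?B"
    then have "finite J" using assms(1) finite_subset by auto
    with J have "card (insert B I) \<le> card J" by (auto intro: card_mono)
    moreover have "card (insert B I) = Suc (card I)"
      using assms True by (simp add: finite_subset)
    ultimately have "card J - card I = Suc (card J - card (insert B I))" by simp
    then show "?f (card I) J = - ?f (card (insert B I)) J" by simp
  qed
  ultimately show ?thesis by (simp add: shearer_Q_def)
next
  case False
  then have "\<not> I \<subseteq> \<C> - {B}" "\<not> insert B I \<subseteq> \<C>" by auto
  with False show ?thesis by (simp add: shearer_Q_not_subset del: insert_subset)
qed

text \<open>For \<open>I = {}\<close> the right-hand side is, up to the factor
  \<open>shearer_Q \<Omega> \<C> {}\<close>, a sum of the kind that defines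
  \<open>shearer_Psi\<close>.\<close>

lemma shearer_Q_remove:
  assumes "finite \<C>" "S \<subseteq> \<C>" "S \<inter> I = {}"
  shows "shearer_Q \<Omega> (\<C> - S) I = (\<Sum>K\<in>Pow S. shearer_Q \<Omega> \<C> (I \<union> K))"
proof -
  have "finite S" using assms finite_subset by auto
  then show ?thesis using assms(2,3)
  proof (induction S arbitrary: I rule: finite_induct)
    case empty then show ?case by simp
  next
    case (insert B S)
    have "shearer_Q \<Omega> (\<C> - insert B S) I = shearer_Q \<Omega> (\<C> - S - {B}) I"
      by (simp only: Diff_insert[of \<C> B S])
    also have "\<dots> = shearer_Q \<Omega> (\<C> - S) I + shearer_Q \<Omega> (\<C> - S) (insert B I)"
      using insert.hyps(2) insert.prems assms(1) by (intro shearer_Q_remove_one) auto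
    also have "\<dots> = (\<Sum>K\<in>Pow S. shearer_Q \<Omega> \<C> (I \<union> K)) +
        (\<Sum>K\<in>Pow S. shearer_Q \<Omega> \<C> (insert B I \<union> K))"
      using insert.hyps(2) insert.prems
      by (intro arg_cong2[of _ _ _ _ "(+)"] insert.IH) auto
    also have "(\<Sum>K\<in>Pow S. shearer_Q \<Omega> \<C> (insert B I \<union> K)) =
        (\<Sum>K\<in>insert B ` Pow S. shearer_Q \<Omega> \<C> (I \<union> K))"
    proof (subst sum.reindex)
      show "inj_on (insert B) (Pow S)"
        using insert.hyps(2) by (auto simp: inj_on_def insert_ident subset_iff)
    qed (simp add: o_def)
    also have "(\<Sum>K\<in>Pow S. shearer_Q \<Omega> \<C> (I \<union> K)) + \<dots> =
        (\<Sum>K\<in>Pow (insert B S). shearer_Q \<Omega> \<C> (I \<union> K))"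
      unfolding Pow_insert using insert.hyps
      by (intro sum.union_disjoint[symmetric]) auto
    finally show ?case .
  qed
qed

lemma shearer_Q_nonneg:
  assumes "shearer_criterion \<Omega> \<B>"
  shows "shearer_Q \<Omega> \<B> I \<ge> 0"
  using assms shearer_Q_unstable[of I \<Omega> \<B>] shearer_Q_not_subset[of I \<B> \<Omega>]
  unfolding shearer_criterion_def by (metis less_eq_real_def)

text \<open>\<open>shearer_Q_remove\<close> expands the value for \<open>\<C>\<close> into values
  for \<open>\<B>\<close>. None is negative, and the one for \<open>K = {}\<close> is
  positive.\<close>

lemma shearer_criterion_subset:
  assumes "shearer_criterion \<Omega> \<B>" "finite \<B>" "\<C> \<subseteq> \<B>"
  shows "shearer_criterion \<Omega> \<C>"
  unfolding shearer_criterion_def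
proof (intro allI impI)
  fix I assume I: "I \<subseteq> \<C> \<and> stable I"
  have "0 < shearer_Q \<Omega> \<B> (I \<union> {})"
    using assms I by (auto simp: shearer_criterion_def)
  also have "\<dots> \<le> (\<Sum>K\<in>Pow (\<B> - \<C>). shearer_Q \<Omega> \<B> (I \<union> K))"
    using assms by (intro member_le_sum shearer_Q_nonneg) auto
  also have "\<dots> = shearer_Q \<Omega> (\<B> - (\<B> - \<C>)) I"
    using assms I by (intro shearer_Q_remove[symmetric]) auto
  also have "\<B> - (\<B> - \<C>) = \<C>" using assms by auto
  finally show "0 < shearer_Q \<Omega> \<C> I" .
qed

text \<open>The argument is a set of variables, so that one notion serves both a single root event
  and a whole layer: \<open>touching \<C> (var E)\<close> is \<open>nbhd \<C> E\<close>.\<close>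

definition touching :: "'a event set \<Rightarrow> nat set \<Rightarrow> 'a event set" where
  "touching \<C> S = {B \<in> \<C>. var B \<inter> S \<noteq> {}}"

abbreviation vars :: "'a event set \<Rightarrow> nat set" where
  "vars J \<equiv> \<Union> (var ` J)"

definition weight :: "(nat \<Rightarrow> 'a) measure \<Rightarrow> 'a event set \<Rightarrow> real" where
  "weight \<Omega> J = (\<Prod>B\<in>J. measure \<Omega> (holds B))"

lemma weight_nonneg: "weight \<Omega> J \<ge> 0"
  by (simp add: weight_def prod_nonneg)

text \<open>A stable superset of \<open>J\<close> adds a stable set sharing no variable with
  \<open>J\<close>, and signs and probabilities factor. \<open>J\<close> is removed explicitly
  because an event with empty \<open>var\<close> does not touch itself.\<close>

lemma shearer_Q_stable:
  assumes "finite \<C>" "J \<subseteq> \<C>" "stable J"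
  shows "shearer_Q \<Omega> \<C> J =
    weight \<Omega> J * shearer_Q \<Omega> (\<C> - (J \<union> touching \<C> (vars J))) {}"
proof -
  have finJ: "finite J" using assms finite_subset by auto
  let ?N = "J \<union> touching \<C> (vars J)"
  have "shearer_Q \<Omega> \<C> J = (\<Sum>K | K \<subseteq> \<C> - ?N \<and> stable K. weight \<Omega> J *
      ((-1) ^ (card K) * (\<Prod>B\<in>K. measure \<Omega> (holds B))))"
    unfolding shearer_Q_def
  proof (rule sum.reindex_bij_witness[of _ "\<lambda>K. J \<union> K" "\<lambda>J'. J' - J"])
    fix J' assume J': "J' \<in> {J'. J \<subseteq> J' \<and> J' \<subseteq> \<C> \<and> stable J'}"
    show "J \<union> (J' - J) = J'" using J' by auto
    show "J' - J \<in> {K. K \<subseteq> \<C> - ?N \<and> stable K}"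
      using J' by (auto simp: stable_def touching_def dependent_events_def pairwise_def)
        (metis IntI empty_iff subsetD)
    have "finite J'" using J' assms finite_subset by auto
    then have "(\<Prod>B\<in>J'. measure \<Omega> (holds B)) = weight \<Omega> J * (\<Prod>B\<in>J'-J. measure \<Omega> (holds B))"
      using J' unfolding weight_def by (subst prod.subset_diff[of J J']) auto
    moreover have "card (J' - J) = card J' - card J"
      using J' finJ by (intro card_Diff_subset) auto
    ultimately show "weight \<Omega> J * ((-1) ^ card (J' - J) * (\<Prod>B\<in>J'-J. measure \<Omega> (holds B))) =
      (-1) ^ (card J' - card J) * (\<Prod>B\<in>J'. measure \<Omega> (holds B))" by simp
  next
    fix K assume K: "K \<in> {K. K \<subseteq> \<C> - ?N \<and> stable K}"
    show "J \<union> K - J = K" using K by auto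
    show "J \<union> K \<in> {J'. J \<subseteq> J' \<and> J' \<subseteq> \<C> \<and> stable J'}"
    proof -
      have indep: "\<not> dependent_events B B'" if "B \<in> J" "B' \<in> K" for B B'
        using that K by (auto simp: touching_def dependent_events_def)
      then have "\<not> dependent_events B' B" if "B \<in> J" "B' \<in> K" for B B'
        using that by (metis dependent_events_def Int_commute)
      with indep have "stable (J \<union> K)"
        using K assms(3) unfolding stable_def pairwise_def by blast
      then show ?thesis using K assms(2) by auto
    qed
  qed
  then show ?thesis by (simp add: shearer_Q_def sum_distrib_left)
qed

lemma shearer_mu_nonneg:
  assumes "shearer_criterion \<Omega> \<C>" shows "shearer_mu \<Omega> \<C> I \<ge> 0"
  using assms by (simp add: shearer_mu_def shearer_Q_nonneg)

lemma shearer_mu_empty: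
  assumes "shearer_criterion \<Omega> \<C>" shows "shearer_mu \<Omega> \<C> {} = 1"
proof -
  have "shearer_Q \<Omega> \<C> {} > 0"
    using assms by (simp add: shearer_criterion_def stable_def)
  then show ?thesis by (simp add: shearer_mu_def)
qed

text \<open>\<open>shearer_Q_stable\<close> and \<open>shearer_Q_remove\<close> give equality with
  subsets of \<open>J \<union> touching \<C> (vars J)\<close>. Dropping the subsets that use members
  of \<open>J\<close> without variables leaves an inequality.\<close>

lemma shearer_mu_recursion:
  assumes "finite \<C>" "shearer_criterion \<Omega> \<C>" "J \<subseteq> \<C>" "stable J"
  shows "weight \<Omega> J * (\<Sum>K\<in>Pow (touching \<C> (vars J)). shearer_mu \<Omega> \<C> K) \<le> shearer_mu \<Omega> \<C> J"
proof -
  let ?N = "J \<union> touching \<C> (vars J)"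
  have N: "?N \<subseteq> \<C>" using assms by (auto simp: touching_def)
  have "(\<Sum>K\<in>Pow (touching \<C> (vars J)). shearer_mu \<Omega> \<C> K) \<le> (\<Sum>K\<in>Pow ?N. shearer_mu \<Omega> \<C> K)"
    using assms N finite_subset[OF N] by (intro sum_mono2 shearer_mu_nonneg) auto
  also have "\<dots> = shearer_Q \<Omega> (\<C> - ?N) {} / shearer_Q \<Omega> \<C> {}"
    unfolding shearer_mu_def sum_divide_distrib[symmetric]
    using assms N by (subst shearer_Q_remove) auto
  finally have "weight \<Omega> J * (\<Sum>K\<in>Pow (touching \<C> (vars J)). shearer_mu \<Omega> \<C> K) \<le>
      weight \<Omega> J * (shearer_Q \<Omega> (\<C> - ?N) {} / shearer_Q \<Omega> \<C> {})"
    by (intro mult_left_mono weight_nonneg)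
  also have "\<dots> = shearer_mu \<Omega> \<C> J"
    using assms by (simp add: shearer_mu_def shearer_Q_stable)
  finally show ?thesis .
qed

text \<open>
  All sequences have length exactly \<open>L\<close>: shorter ones are padded with empty layers. The head is
  the layer nearest to the root, that is, the one resampled last.
\<close>

primrec chains :: "'a event set \<Rightarrow> nat \<Rightarrow> nat set \<Rightarrow> 'a event set list set" where
  "chains \<C> 0 S = {[]}"
| "chains \<C> (Suc L) S =
     (\<Union>K\<in>{K. K \<subseteq> touching \<C> S \<and> stable K}. (#) K ` chains \<C> L (vars K))"

lemma finite_stable_touching:
  "finite \<C> \<Longrightarrow> finite {K. K \<subseteq> touching \<C> S \<and> stable K}"
  by (rule finite_subset[of _ "Pow \<C>"]) (auto simp: touching_def)

lemma finite_chains: "finite \<C> \<Longrightarrow> finite (chains \<C> L S)"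
  by (induction L arbitrary: S) (auto simp: finite_stable_touching)

text \<open>Split off the first layer, bound the rest by induction, and collapse with
  \<open>shearer_mu_recursion\<close>. The bound is uniform in \<open>L\<close>, so that chains of
  unbounded length can be treated as a limit.\<close>

lemma sum_chains_le:
  assumes "finite \<C>" "shearer_criterion \<Omega> \<C>"
  shows "(\<Sum>Js\<in>chains \<C> L S. \<Prod>J\<leftarrow>Js. weight \<Omega> J)
    \<le> (\<Sum>K\<in>Pow (touching \<C> S). shearer_mu \<Omega> \<C> K)"
proof (induction L arbitrary: S)
  case 0
  have "shearer_mu \<Omega> \<C> {} \<le> (\<Sum>K\<in>Pow (touching \<C> S). shearer_mu \<Omega> \<C> K)"
    using assms by (intro member_le_sum shearer_mu_nonneg) (auto simp: touching_def)
  then show ?case using shearer_mu_empty[OF assms(2)] by simp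
next
  case (Suc L)
  let ?X = "{K. K \<subseteq> touching \<C> S \<and> stable K}"
  have "(\<Sum>Js\<in>chains \<C> (Suc L) S. \<Prod>J\<leftarrow>Js. weight \<Omega> J) =
      (\<Sum>K\<in>?X. \<Sum>Js\<in>(#) K ` chains \<C> L (vars K). \<Prod>J\<leftarrow>Js. weight \<Omega> J)"
    unfolding chains.simps using assms
    by (intro sum.UNION_disjoint) (auto simp: finite_stable_touching finite_chains)
  also have "\<dots> = (\<Sum>K\<in>?X. weight \<Omega> K * (\<Sum>Js\<in>chains \<C> L (vars K). \<Prod>J\<leftarrow>Js. weight \<Omega> J))"
    by (subst sum.reindex) (auto simp: sum_distrib_left)
  also have "\<dots> \<le> (\<Sum>K\<in>?X. weight \<Omega> K * (\<Sum>K'\<in>Pow (touching \<C> (vars K)). shearer_mu \<Omega> \<C> K'))"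
    by (intro sum_mono mult_left_mono Suc.IH weight_nonneg)
  also have "\<dots> \<le> (\<Sum>K\<in>?X. shearer_mu \<Omega> \<C> K)"
    using assms by (intro sum_mono shearer_mu_recursion) (auto simp: touching_def)
  \<comment> \<open>No term is negative, so the restriction to stable layers can be lifted.\<close>
  also have "\<dots> \<le> (\<Sum>K\<in>Pow (touching \<C> S). shearer_mu \<Omega> \<C> K)"
    using assms by (intro sum_mono2 shearer_mu_nonneg) (auto simp: touching_def)
  finally show ?case .
qed

lemma sum_chains_le_Psi:
  assumes "finite \<C>" "shearer_criterion \<Omega> \<C>"
  shows "(\<Sum>Js\<in>chains \<C> L (var E). \<Prod>J\<leftarrow>Js. weight \<Omega> J) \<le> shearer_Psi \<Omega> \<C> E"
  using sum_chains_le[OF assms, of L "var E"]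
  by (simp add: shearer_Psi_def Pow_def touching_def nbhd_def dependent_events_def)

section \<open>Resampling tables\<close>

type_synonym 'a table = "nat \<times> nat \<Rightarrow> 'a"

text \<open>Row 0 always holds the current values. The restriction makes it extensional, hence a
  point of \<open>assignments n M\<close>.\<close>

definition top_row :: "nat \<Rightarrow> 'a table \<Rightarrow> nat \<Rightarrow> 'a" where
  "top_row n T = (\<lambda>k\<in>{1..n}. T (k, 0))"

text \<open>Resampling \<open>V\<close> deletes the current entries of these columns and moves the
  later ones up, so no counters of past resamplings have to be stored.\<close>

definition shift :: "nat set \<Rightarrow> 'a table \<Rightarrow> 'a table" where
  "shift V T = (\<lambda>(k, p). T (k, if k \<in> V then Suc p else p))"

lemma shift_empty [simp]: "shift {} T = T"
  by (simp add: shift_def)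

lemma shift_commute: "shift V (shift W T) = shift W (shift V T)"
  by (auto simp: shift_def fun_eq_iff)

lemma shift_Un: "V \<inter> W = {} \<Longrightarrow> shift (V \<union> W) T = shift W (shift V T)"
  by (auto simp: shift_def fun_eq_iff)

lemma shift_outside: "k \<notin> V \<Longrightarrow> shift V T (k, p) = T (k, p)"
  by (simp add: shift_def)

section \<open>Words of resamplings and sequences of layers\<close>

primrec shifts :: "'a event list \<Rightarrow> 'a table \<Rightarrow> 'a table" where
  "shifts [] T = T"
| "shifts (B # v) T = shifts v (shift (var B) T)"

text \<open>These words are the legal logs of resamplings; they need not come from the selection
  rule.\<close>

primrec occurs :: "nat \<Rightarrow> 'a event list \<Rightarrow> 'a table \<Rightarrow> bool" where
  "occurs n [] T \<longleftrightarrow> True"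
| "occurs n (B # v) T \<longleftrightarrow> top_row n T \<in> holds B \<and> occurs n v (shift (var B) T)"

text \<open>The tail is treated first because the head of a chain is the layer resampled
  last.\<close>

primrec unwind :: "'a event set list \<Rightarrow> 'a table \<Rightarrow> 'a table" where
  "unwind [] T = T"
| "unwind (J # Js) T = shift (vars J) (unwind Js T)"

primrec consistent :: "nat \<Rightarrow> 'a event set list \<Rightarrow> 'a table \<Rightarrow> bool" where
  "consistent n [] T \<longleftrightarrow> True"
| "consistent n (J # Js) T \<longleftrightarrow>
     consistent n Js T \<and> (\<forall>B\<in>J. top_row n (unwind Js T) \<in> holds B)"

lemma shifts_append: "shifts (v @ w) T = shifts w (shifts v T)"
  by (induction v arbitrary: T) auto

lemma occurs_append: "occurs n (v @ w) T \<longleftrightarrow> occurs n v T \<and> occurs n w (shifts v T)"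
  by (induction v arbitrary: T) auto

lemma shift_unwind: "shift V (unwind Js T) = unwind Js (shift V T)"
  by (induction Js) (simp_all, metis shift_commute)

lemma unwind_outside: "k \<notin> V \<Longrightarrow> unwind Js (shift V T) (k, p) = unwind Js T (k, p)"
  by (simp add: shift_unwind[symmetric] shift_outside)

lemma chains_Cons_iff:
  "J # Js \<in> chains \<C> (Suc L) S \<longleftrightarrow> J \<subseteq> touching \<C> S \<and> stable J \<and> Js \<in> chains \<C> L (vars J)"
  by auto

text \<open>An empty layer at the deep end requires and resamples nothing. It equalises lengths in
  \<open>chain_insert\<close> and lets longer chains cover shorter ones.\<close>

lemma chains_pad: "Js \<in> chains \<C> L S \<Longrightarrow> Js @ [{}] \<in> chains \<C> (Suc L) S"
proof (induction L arbitrary: S Js)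
  case 0 then show ?case by (auto simp: stable_def)
next
  case (Suc L)
  then obtain J Js' where "Js = J # Js'" "J \<subseteq> touching \<C> S" "stable J"
    "Js' \<in> chains \<C> L (vars J)" by auto
  with Suc.IH show ?case by (simp only: append_Cons chains_Cons_iff simp_thms)
qed

lemma chains_mono: "S \<subseteq> S' \<Longrightarrow> chains \<C> L S \<subseteq> chains \<C> L S'"
proof (cases L)
  case (Suc L')
  assume "S \<subseteq> S'"
  then have "{K. K \<subseteq> touching \<C> S \<and> stable K} \<subseteq> {K. K \<subseteq> touching \<C> S' \<and> stable K}"
    unfolding touching_def by blast
  then show ?thesis unfolding Suc chains.simps by (rule UN_mono) (rule order_refl)
qed simp

lemma unwind_pad [simp]: "unwind (Js @ [{}]) T = unwind Js T"
  by (induction Js) auto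

lemma consistent_pad [simp]: "consistent n (Js @ [{}]) T = consistent n Js T"
  by (induction Js) auto

lemma unwind_untouched:
  "(\<And>J. J \<in> set Js \<Longrightarrow> k \<notin> vars J) \<Longrightarrow> unwind Js T (k, p) = T (k, p)"
proof (induction Js)
  case (Cons J Js)
  have "k \<notin> vars J" by (intro Cons.prems) simp
  moreover have "unwind Js T (k, p) = T (k, p)" by (intro Cons.IH Cons.prems) simp
  ultimately show ?case by (metis unwind.simps(2) shift_outside)
qed simp

definition tables :: "nat \<Rightarrow> (nat \<Rightarrow> 'a measure) \<Rightarrow> 'a table measure" where
  "tables n M = PiM ({1..n} \<times> UNIV) (\<lambda>(k, p). M k)"

lemma space_tables_iff:
  "T \<in> space (tables n M) \<longleftrightarrow>
    (\<forall>k p. if k \<in> {1..n} then T (k, p) \<in> space (M k) else T (k, p) = undefined)"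
  by (auto simp: tables_def space_PiM PiE_iff extensional_def split: if_splits)

lemma shift_in_space: "T \<in> space (tables n M) \<Longrightarrow> shift V T \<in> space (tables n M)"
  unfolding space_tables_iff by (auto simp: shift_def)

lemma shifts_in_space: "T \<in> space (tables n M) \<Longrightarrow> shifts v T \<in> space (tables n M)"
  by (induction v arbitrary: T) (auto intro: shift_in_space)

lemma unwind_in_space: "T \<in> space (tables n M) \<Longrightarrow> unwind Js T \<in> space (tables n M)"
  by (induction Js) (auto intro: shift_in_space)

lemma top_row_in_space:
  "T \<in> space (tables n M) \<Longrightarrow> top_row n T \<in> space (assignments n M)"
  unfolding space_tables_iff by (auto simp: top_row_def assignments_def space_PiM)

section \<open>Passing between words and chains on a fixed table\<close>

locale event_family =
  fixes n :: nat and M :: "nat \<Rightarrow> 'a measure" and \<B> :: "'a event set"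
  assumes events: "B \<in> \<B> \<Longrightarrow> is_event n M B"
    and finite_family: "finite \<B>"
begin

lemma var_subset: "B \<in> \<B> \<Longrightarrow> var B \<subseteq> {1..n}"
  using events by (auto simp: is_event_def)

lemma holds_cong:
  assumes "B \<in> \<B>" "x \<in> space (assignments n M)" "y \<in> space (assignments n M)"
    "\<And>k. k \<in> var B \<Longrightarrow> x k = y k"
  shows "x \<in> holds B \<longleftrightarrow> y \<in> holds B"
  using events[OF assms(1)] assms(2-4) unfolding is_event_def by blast

lemma top_row_cong:
  assumes "B \<in> \<B>" "T \<in> space (tables n M)" "T' \<in> space (tables n M)"
    "\<And>k. k \<in> var B \<Longrightarrow> T (k, 0) = T' (k, 0)"
  shows "top_row n T \<in> holds B \<longleftrightarrow> top_row n T' \<in> holds B"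
  using assms by (intro holds_cong top_row_in_space) (auto simp: top_row_def)

lemma consistent_shift:
  assumes "T \<in> space (tables n M)" "\<And>J. J \<in> set Js \<Longrightarrow> J \<subseteq> \<B> \<and> V \<inter> vars J = {}"
  shows "consistent n Js (shift V T) \<longleftrightarrow> consistent n Js T"
  using assms(2)
proof (induction Js)
  case (Cons J Js)
  have "top_row n (unwind Js (shift V T)) \<in> holds B \<longleftrightarrow> top_row n (unwind Js T) \<in> holds B"
    if "B \<in> J" for B
    using that Cons.prems[of J] assms(1)
    by (intro top_row_cong unwind_in_space shift_in_space unwind_outside) auto
  with Cons show ?case by auto
qed simp

lemma chains_layers: "Js \<in> chains \<C> L S \<Longrightarrow> J \<in> set Js \<Longrightarrow> J \<subseteq> \<C> \<and> stable J"
proof (induction L arbitrary: S Js)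
  case (Suc L)
  then obtain J' Ks where "Js = J' # Ks" "J' \<subseteq> touching \<C> S" "stable J'"
    "Ks \<in> chains \<C> L (vars J')" by auto
  moreover have "touching \<C> S \<subseteq> \<C>" by (auto simp: touching_def)
  ultimately show ?case using Suc.IH[of Ks "vars J'"] Suc.prems(2) by (metis set_ConsD subset_trans)
qed simp

text \<open>Here \<open>B\<close> is resampled before everything in the chain. It goes directly
  below the deepest layer it meets, with \<open>S\<close> counted as the top; if it meets none, the
  first alternative holds. This choice keeps its layer stable and the layers below free of its
  variables.\<close>

lemma chain_insert:
  assumes "\<C> \<subseteq> \<B>" "T \<in> space (tables n M)" "B \<in> \<C>" "top_row n T \<in> holds B"
    and "Js \<in> chains \<C> L S" "consistent n Js (shift (var B) T)"
  shows "var B \<inter> S = {} \<and> (\<forall>J\<in>set Js. var B \<inter> vars J = {}) \<or>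
    (\<exists>Js'\<in>chains \<C> (Suc L) S. consistent n Js' T \<and>
      unwind Js' T = unwind Js (shift (var B) T))"
  using assms(5,6)
proof (induction L arbitrary: Js S)
  case 0
  show ?case
  proof (cases "var B \<inter> S = {}")
    case False
    then have "[{B}] \<in> chains \<C> (Suc 0) S"
      using assms(3) by (auto simp: touching_def stable_def)
    moreover have "consistent n [{B}] T" using assms(4) by simp
    moreover have "unwind [{B}] T = unwind Js (shift (var B) T)" using 0 by simp
    ultimately show ?thesis by blast
  qed (use 0 in simp)
next
  case (Suc L)
  then obtain J Ks where Js: "Js = J # Ks" and J: "J \<subseteq> touching \<C> S" "stable J"
    and Ks: "Ks \<in> chains \<C> L (vars J)" by auto
  have cons: "consistent n Ks (shift (var B) T)"
    "\<And>B'. B' \<in> J \<Longrightarrow> top_row n (unwind Ks (shift (var B) T)) \<in> holds B'"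
    using Suc.prems Js by auto
  consider (deep) Ks' where "Ks' \<in> chains \<C> (Suc L) (vars J)" "consistent n Ks' T"
      "unwind Ks' T = unwind Ks (shift (var B) T)"
    | (here) "var B \<inter> vars J = {}" "\<forall>J\<in>set Ks. var B \<inter> vars J = {}" "var B \<inter> S \<noteq> {}"
    | (none) "var B \<inter> vars J = {}" "\<forall>J\<in>set Ks. var B \<inter> vars J = {}" "var B \<inter> S = {}"
    using Suc.IH[OF Ks cons(1)] by blast
  then show ?case
  proof cases
    case deep
    have "J # Ks' \<in> chains \<C> (Suc (Suc L)) S"
      using deep(1) J by (simp only: chains_Cons_iff simp_thms)
    moreover have "consistent n (J # Ks') T" using deep cons by simp
    moreover have "unwind (J # Ks') T = unwind Js (shift (var B) T)" using deep Js by simp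
    ultimately show ?thesis by blast
  next
    case none then show ?thesis using Js by simp
  next
    case here
    \<comment> \<open>\<open>B\<close> joins an existing layer, so padding supplies the required
      length.\<close>
    let ?Js' = "insert B J # (Ks @ [{}])"
    have "Ks @ [{}] \<in> chains \<C> (Suc L) (vars (insert B J))"
      using chains_pad[OF Ks] chains_mono[of "vars J" "vars (insert B J)" \<C> "Suc L"]
      by (metis Un_upper2 UN_insert subsetD)
    moreover have "stable (insert B J)"
      using J(2) here(1) unfolding stable_def pairwise_insert dependent_events_def by blast
    moreover have "insert B J \<subseteq> touching \<C> S"
      using here(3) J(1) assms(3) by (auto simp: touching_def)
    ultimately have chain: "?Js' \<in> chains \<C> (Suc (Suc L)) S"
      by (simp only: chains_Cons_iff simp_thms)
    have "consistent n Ks (shift (var B) T) \<longleftrightarrow> consistent n Ks T"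
    proof (rule consistent_shift[OF assms(2)])
      fix J' assume "J' \<in> set Ks"
      then show "J' \<subseteq> \<B> \<and> var B \<inter> vars J' = {}"
        using chains_layers[OF Ks] assms(1) here(2) by (meson subset_trans)
    qed
    with cons(1) have "consistent n Ks T" by simp
    \<comment> \<open>The layers of \<open>Ks\<close> leave the columns of \<open>B\<close> alone,
      so \<open>B\<close> still finds the original row 0.\<close>
    moreover have "top_row n (unwind Ks T) \<in> holds B \<longleftrightarrow> top_row n T \<in> holds B"
    proof (rule top_row_cong[OF _ unwind_in_space[OF assms(2)] assms(2)])
      show "B \<in> \<B>" using assms(1,3) by (rule subsetD)
      show "unwind Ks T (k, 0) = T (k, 0)" if "k \<in> var B" for k
        using that here(2) by (intro unwind_untouched) (meson disjoint_iff)
    qed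
    \<comment> \<open>Members of \<open>J\<close> share no variable with \<open>B\<close>, so it is
      irrelevant to them whether \<open>B\<close> has been resampled yet.\<close>
    moreover have "top_row n (unwind Ks T) \<in> holds B'" if "B' \<in> J" for B'
    proof (rule top_row_cong[THEN iffD2])
      show "top_row n (unwind Ks (shift (var B) T)) \<in> holds B'" by (rule cons(2)[OF that])
      show "B' \<in> \<B>" using that J(1) assms(1) unfolding touching_def by blast
      show "unwind Ks T (k, 0) = unwind Ks (shift (var B) T) (k, 0)" if "k \<in> var B'" for k
        using that here(1) \<open>B' \<in> J\<close> by (intro unwind_outside[symmetric]) blast
    qed (intro unwind_in_space shift_in_space assms(2))+
    ultimately have "consistent n ?Js' T" using assms(4) by simp
    moreover have "unwind ?Js' T = unwind Js (shift (var B) T)"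
      using here(1) by (simp add: Js shift_Un shift_unwind)
    ultimately show ?thesis using chain by blast
  qed
qed

text \<open>The chain is built from the end of the word: each earlier event is inserted by
  \<open>chain_insert\<close> or dropped if it does not influence \<open>S\<close>. Because of the
  drops the two tables agree only in the columns of \<open>S\<close>.\<close>

lemma word_to_chain:
  assumes "\<C> \<subseteq> \<B>" "v \<in> lists \<C>" "T \<in> space (tables n M)" "occurs n v T"
  shows "\<exists>Js\<in>chains \<C> (length v) S. consistent n Js T \<and>
    (\<forall>k\<in>S. \<forall>p. unwind Js T (k, p) = shifts v T (k, p))"
  using assms(2-)
proof (induction v arbitrary: T rule: list.induct)
  case (Cons B v)
  have "\<exists>Js\<in>chains \<C> (length v) S. consistent n Js (shift (var B) T) \<and>
    (\<forall>k\<in>S. \<forall>p. unwind Js (shift (var B) T) (k, p) = shifts v (shift (var B) T) (k, p))"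
    by (rule Cons.IH) (use Cons.prems in \<open>simp_all add: shift_in_space\<close>)
  then obtain Js where Js: "Js \<in> chains \<C> (length v) S" "consistent n Js (shift (var B) T)"
    "\<forall>k\<in>S. \<forall>p. unwind Js (shift (var B) T) (k, p) = shifts v (shift (var B) T) (k, p)"
    by blast
  have B: "B \<in> \<C>" "top_row n T \<in> holds B" using Cons.prems(1,3) by simp_all
  from chain_insert[OF assms(1) Cons.prems(2) B Js(1,2)] show ?case
  proof
    assume disj: "var B \<inter> S = {} \<and> (\<forall>J\<in>set Js. var B \<inter> vars J = {})"
    have "consistent n Js (shift (var B) T) \<longleftrightarrow> consistent n Js T"
    proof (rule consistent_shift[OF Cons.prems(2)])
      fix J assume "J \<in> set Js"
      then show "J \<subseteq> \<B> \<and> var B \<inter> vars J = {}"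
        using chains_layers[OF Js(1)] assms(1) disj by (meson subset_trans)
    qed
    with Js(2) have "consistent n Js T" by simp
    moreover have "unwind Js T (k, p) = shifts (B # v) T (k, p)" if "k \<in> S" for k p
    proof -
      have "k \<notin> var B" using that disj by blast
      then show ?thesis using Js(3) that by (metis unwind_outside shifts.simps(2))
    qed
    ultimately have "consistent n (Js @ [{}]) T \<and>
        (\<forall>k\<in>S. \<forall>p. unwind (Js @ [{}]) T (k, p) = shifts (B # v) T (k, p))"
      by (simp only: unwind_pad consistent_pad) blast
    then show ?thesis
      using chains_pad[OF Js(1)] unfolding length_Cons by (rule bexI)
  next
    assume "\<exists>Js'\<in>chains \<C> (Suc (length v)) S. consistent n Js' T \<and>
      unwind Js' T = unwind Js (shift (var B) T)"
    then obtain Js' where Js': "Js' \<in> chains \<C> (Suc (length v)) S" "consistent n Js' T"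
      "unwind Js' T = unwind Js (shift (var B) T)" by blast
    have "consistent n Js' T \<and> (\<forall>k\<in>S. \<forall>p. unwind Js' T (k, p) = shifts (B # v) T (k, p))"
      using Js(3) Js'(2,3) by (simp only: shifts.simps)
    then show ?thesis using Js'(1) unfolding length_Cons by (rule bexI)
  qed
qed simp

text \<open>Members of a stable layer have disjoint variables, so resampling one leaves the others
  true, in any order.\<close>

lemma layer_to_word:
  assumes "finite J" "J \<subseteq> \<B>" "J \<subseteq> \<C>" "stable J" "T \<in> space (tables n M)"
    "\<And>B. B \<in> J \<Longrightarrow> top_row n T \<in> holds B"
  shows "\<exists>v\<in>lists \<C>. occurs n v T \<and> shifts v T = shift (vars J) T"
  using assms
proof (induction J arbitrary: T rule: finite_induct)
  case empty then show ?case by (intro bexI[of _ "[]"]) auto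
next
  case (insert B J)
  have disj: "var B \<inter> var B' = {}" if "B' \<in> J" for B'
    using insert.prems(3) insert.hyps(2) that
    by (auto simp: stable_def pairwise_def dependent_events_def)
  have "\<exists>v\<in>lists \<C>. occurs n v (shift (var B) T) \<and>
    shifts v (shift (var B) T) = shift (vars J) (shift (var B) T)"
  proof (rule insert.IH)
    show "top_row n (shift (var B) T) \<in> holds B'" if "B' \<in> J" for B'
    proof (rule top_row_cong[THEN iffD2])
      show "B' \<in> \<B>" "top_row n T \<in> holds B'" using that insert.prems(1,5) by auto
      show "shift (var B) T (k, 0) = T (k, 0)" if "k \<in> var B'" for k
        using that disj[OF \<open>B' \<in> J\<close>] by (intro shift_outside) blast
    qed (intro shift_in_space insert.prems(4))+
    show "stable J"
      using insert.prems(3) unfolding stable_def by (rule pairwise_subset) blast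
  qed (use insert.prems(1,2,4) in \<open>simp_all add: shift_in_space\<close>)
  then obtain v where v: "v \<in> lists \<C>" "occurs n v (shift (var B) T)"
    "shifts v (shift (var B) T) = shift (vars J) (shift (var B) T)" by blast
  have "shift (vars (insert B J)) T = shift (vars J) (shift (var B) T)"
    using disj by (simp only: image_insert Union_insert, intro shift_Un) blast
  moreover have "top_row n T \<in> holds B" "B \<in> \<C>" using insert.prems by blast+
  ultimately show ?case using v by (intro bexI[of _ "B # v"]) simp_all
qed

text \<open>The layers are executed from the deepest up. This allows a chain to compete as a word in
  the choice of a least index.\<close>

lemma chain_to_word:
  assumes "\<C> \<subseteq> \<B>" "T \<in> space (tables n M)" "Js \<in> chains \<C> L S" "consistent n Js T"
  shows "\<exists>v\<in>lists \<C>. occurs n v T \<and> shifts v T = unwind Js T"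
  using assms(3,4)
proof (induction L arbitrary: Js S)
  case 0 then show ?case by (intro bexI[of _ "[]"]) auto
next
  case (Suc L)
  then obtain J Ks where Js: "Js = J # Ks" and J: "J \<subseteq> touching \<C> S" "stable J"
    and Ks: "Ks \<in> chains \<C> L (vars J)" by auto
  obtain v where v: "v \<in> lists \<C>" "occurs n v T" "shifts v T = unwind Ks T"
    using Suc.IH[OF Ks] Suc.prems Js by auto
  have JC: "J \<subseteq> \<C>" using J by (auto simp: touching_def)
  have "\<exists>w\<in>lists \<C>. occurs n w (unwind Ks T) \<and> shifts w (unwind Ks T) = shift (vars J) (unwind Ks T)"
  proof (rule layer_to_word[OF _ _ JC J(2) unwind_in_space[OF assms(2)]])
    show "J \<subseteq> \<B>" using JC assms(1) by (rule subset_trans)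
    then show "finite J" using finite_family by (rule finite_subset)
    show "top_row n (unwind Ks T) \<in> holds B" if "B \<in> J" for B
      using that Suc.prems(2) Js by simp
  qed
  then obtain w where "w \<in> lists \<C>" "occurs n w (unwind Ks T)"
    "shifts w (unwind Ks T) = shift (vars J) (unwind Ks T)" by blast
  with v Js show ?case
    by (intro bexI[of _ "v @ w"]) (simp_all add: occurs_append shifts_append)
qed

text \<open>
  For the least index \<open>j\<close> whose event holds after some word, the first \<open>j\<close> events fail after the
  chain below \<open>Bs ! j\<close>, since otherwise that chain itself would be a word for a smaller index.
\<close>

lemma minimal_chain:
  assumes "\<C> \<subseteq> \<B>" "T \<in> space (tables n M)"
    and Bs: "set Bs = {B \<in> \<C>. i \<in> var B}"
    and "v \<in> lists \<C>" "B \<in> \<C>" "i \<in> var B" "occurs n v T"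
    and "top_row n (shifts v T) \<in> holds B" "shifts v T (i, 1) \<in> D"
  shows "\<exists>L. \<exists>j<length Bs. \<exists>Js\<in>chains \<C> L (var (Bs ! j)). consistent n Js T \<and>
    (top_row n (unwind Js T) \<in> holds (Bs ! j) \<and>
      (\<forall>k<j. top_row n (unwind Js T) \<notin> holds (Bs ! k))) \<and> unwind Js T (i, 1) \<in> D"
proof -
  let ?P = "\<lambda>j. j < length Bs \<and> (\<exists>v\<in>lists \<C>. occurs n v T \<and>
    top_row n (shifts v T) \<in> holds (Bs ! j) \<and> shifts v T (i, 1) \<in> D)"
  have "B \<in> set Bs" using assms by auto
  then have "\<exists>j. ?P j" using assms unfolding in_set_conv_nth by blast
  then obtain j where j: "?P j" "\<And>k. k < j \<Longrightarrow> \<not> ?P k"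
    using exists_least_iff[of ?P] by blast
  then obtain v where v: "v \<in> lists \<C>" "occurs n v T"
    "top_row n (shifts v T) \<in> holds (Bs ! j)" "shifts v T (i, 1) \<in> D" by blast
  have Bj: "Bs ! j \<in> \<C>" "i \<in> var (Bs ! j)" using j(1) Bs nth_mem by blast+
  obtain Js where Js: "Js \<in> chains \<C> (length v) (var (Bs ! j))" "consistent n Js T"
    and agree: "\<forall>k\<in>var (Bs ! j). \<forall>p. unwind Js T (k, p) = shifts v T (k, p)"
    using word_to_chain[OF assms(1) v(1) assms(2) v(2)] by blast
  have hit: "top_row n (unwind Js T) \<in> holds (Bs ! j)"
  proof (rule top_row_cong[THEN iffD2, OF _ unwind_in_space shifts_in_space])
    show "Bs ! j \<in> \<B>" using Bj(1) assms(1) by blast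
  qed (use assms(2) v(3) agree in simp_all)
  have D: "unwind Js T (i, 1) \<in> D" using v(4) agree Bj by simp
  obtain w where w: "w \<in> lists \<C>" "occurs n w T" "shifts w T = unwind Js T"
    using chain_to_word[OF assms(1,2) Js] by blast
  have "top_row n (unwind Js T) \<notin> holds (Bs ! k)" if "k < j" for k
    using j(2)[OF that] j(1) that w D by (metis order.strict_trans)
  with Js hit D j(1) show ?thesis by blast
qed

end

section \<open>The law of a table\<close>

text \<open>Reverses a resampling of \<open>V\<close>: it displays a table as the values on top of
  these columns together with what \<open>shift V\<close> leaves.\<close>

definition push :: "nat set \<Rightarrow> (nat \<Rightarrow> 'a) \<Rightarrow> 'a table \<Rightarrow> 'a table" where
  "push V s T =
    (\<lambda>(k, p). if k \<in> V then (case p of 0 \<Rightarrow> s k | Suc q \<Rightarrow> T (k, q)) else T (k, p))"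

lemma shift_push [simp]: "shift V (push V s T) = T"
  by (auto simp: shift_def push_def fun_eq_iff)

lemma push_top: "k \<in> V \<Longrightarrow> push V s T (k, 0) = s k"
  by (simp add: push_def)

lemma emeasure_box:
  assumes "\<And>i. i \<in> I \<Longrightarrow> prob_space (W i)" "finite J" "J \<subseteq> I" "\<And>i. i \<in> J \<Longrightarrow> A i \<in> sets (W i)"
  shows "emeasure (PiM I W) {x \<in> space (PiM I W). \<forall>i\<in>J. x i \<in> A i} = (\<Prod>i\<in>J. emeasure (W i) (A i))"
    and "{x \<in> space (PiM I W). \<forall>i\<in>J. x i \<in> A i} \<in> sets (PiM I W)"
proof -
  have eq: "{x \<in> space (PiM I W). \<forall>i\<in>J. x i \<in> A i} = prod_emb I W J (Pi\<^sub>E J A)"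
    using assms(3) by (auto simp: prod_emb_def space_PiM PiE_iff extensional_def)
  show "emeasure (PiM I W) {x \<in> space (PiM I W). \<forall>i\<in>J. x i \<in> A i} = (\<Prod>i\<in>J. emeasure (W i) (A i))"
    unfolding eq using assms by (intro emeasure_PiM_emb) auto
  show "{x \<in> space (PiM I W). \<forall>i\<in>J. x i \<in> A i} \<in> sets (PiM I W)"
    unfolding eq using assms by (intro sets_PiM_I) auto
qed

section \<open>Fresh rows and independence\<close>

locale variable_setting =
  fixes n :: nat and M :: "nat \<Rightarrow> 'a measure"
  assumes prob_M: "k \<in> {1..n} \<Longrightarrow> prob_space (M k)"
begin

abbreviation "\<Omega> \<equiv> assignments n M"

sublocale \<Omega>: prob_space \<Omega>
  unfolding assignments_def by (rule prob_space_PiM) (rule prob_M)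

sublocale tables: prob_space "tables n M"
  unfolding tables_def by (rule prob_space_PiM) (auto intro: prob_M)

lemma measurable_coord: "k \<in> {1..n} \<Longrightarrow> (\<lambda>x. x k) \<in> \<Omega> \<rightarrow>\<^sub>M M k"
  unfolding assignments_def by (rule measurable_component_singleton)

lemma measurable_table_entry: "k \<in> {1..n} \<Longrightarrow> (\<lambda>T. T (k, p)) \<in> tables n M \<rightarrow>\<^sub>M M k"
  unfolding tables_def
  using measurable_component_singleton[of "(k, p)" "{1..n} \<times> UNIV" "\<lambda>(k, p). M k"] by simp

lemma measurable_top_row: "top_row n \<in> tables n M \<rightarrow>\<^sub>M \<Omega>"
  unfolding top_row_def[abs_def] assignments_def
  by (rule measurable_restrict) (rule measurable_table_entry)

lemma measurable_into_tables:
  assumes "\<And>k p. k \<in> {1..n} \<Longrightarrow> (\<lambda>x. f x (k, p)) \<in> N \<rightarrow>\<^sub>M M k"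
    and "\<And>x. x \<in> space N \<Longrightarrow> f x \<in> space (tables n M)"
  shows "f \<in> N \<rightarrow>\<^sub>M tables n M"
proof -
  have "(\<lambda>x z. f x z) \<in> N \<rightarrow>\<^sub>M PiM ({1..n} \<times> UNIV) (\<lambda>(k, p). M k)"
    using assms by (intro measurable_PiM_single') (auto simp: tables_def space_PiM)
  then show ?thesis by (simp add: tables_def)
qed

lemma measurable_shift: "shift V \<in> tables n M \<rightarrow>\<^sub>M tables n M"
proof (rule measurable_into_tables)
  show "(\<lambda>T. shift V T (k, p)) \<in> tables n M \<rightarrow>\<^sub>M M k" if "k \<in> {1..n}" for k p
    using measurable_table_entry[OF that] by (simp add: shift_def)
qed (rule shift_in_space)

lemma push_in_space:
  "V \<subseteq> {1..n} \<Longrightarrow> s \<in> space \<Omega> \<Longrightarrow> T \<in> space (tables n M) \<Longrightarrow> push V s T \<in> space (tables n M)"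
  unfolding space_tables_iff
  by (auto simp: push_def assignments_def space_PiM split: nat.split)

lemma measurable_push:
  assumes "V \<subseteq> {1..n}"
  shows "(\<lambda>(s, T). push V s T) \<in> \<Omega> \<Otimes>\<^sub>M tables n M \<rightarrow>\<^sub>M tables n M"
proof (rule measurable_into_tables)
  fix k p assume k: "k \<in> {1..n}"
  have T: "(\<lambda>x. snd x (k, q)) \<in> \<Omega> \<Otimes>\<^sub>M tables n M \<rightarrow>\<^sub>M M k" for q
    by (rule measurable_compose[OF measurable_snd measurable_table_entry[OF k]])
  have s: "(\<lambda>x. fst x k) \<in> \<Omega> \<Otimes>\<^sub>M tables n M \<rightarrow>\<^sub>M M k"
    by (rule measurable_compose[OF measurable_fst measurable_coord[OF k]])
  show "(\<lambda>x. (case x of (s, T) \<Rightarrow> push V s T) (k, p)) \<in> \<Omega> \<Otimes>\<^sub>M tables n M \<rightarrow>\<^sub>M M k"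
  proof -
    have eq: "(\<lambda>x. (case x of (s, T) \<Rightarrow> push V s T) (k, p)) =
      (\<lambda>x. if k \<in> V then case p of 0 \<Rightarrow> fst x k | Suc q \<Rightarrow> snd x (k, q) else snd x (k, p))"
      by (auto simp: push_def fun_eq_iff split: nat.split)
    show ?thesis unfolding eq using T s by (cases p) auto
  qed
next
  fix x assume "x \<in> space (\<Omega> \<Otimes>\<^sub>M tables n M)"
  then show "(case x of (s, T) \<Rightarrow> push V s T) \<in> space (tables n M)"
    using assms by (auto simp: space_pair_measure simp del: One_nat_def intro: push_in_space)
qed

text \<open>A push only relabels independent coordinates, each keeping the law of its column. It
  suffices to compare finite boxes.\<close>

lemma distr_push:
  assumes V: "V \<subseteq> {1..n}"
  shows "distr (\<Omega> \<Otimes>\<^sub>M tables n M) (tables n M) (\<lambda>(s, T). push V s T) = tables n M"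
proof -
  define I where "I = {1..n} \<times> (UNIV :: nat set)"
  define W where "W = (\<lambda>(k :: nat, p :: nat). M k)"
  have tab: "tables n M = PiM I W" by (simp add: tables_def I_def W_def)
  have prob_W: "prob_space (W z)" if "z \<in> I" for z
    using that prob_M by (auto simp: W_def I_def)
  have "PiM I W = distr (\<Omega> \<Otimes>\<^sub>M tables n M) (tables n M) (\<lambda>(s, T). push V s T)"
  proof (rule measure_eqI_PiM_infinite)
    fix A J assume J: "finite J" "J \<subseteq> I" and A: "\<And>z. z \<in> J \<Longrightarrow> A z \<in> sets (W z)"
    \<comment> \<open>\<open>e\<close> sends the position of an entry of the old table to its
      position after the push.\<close>
    define e where "e = (\<lambda>(k :: nat, p :: nat). if k \<in> V then (k, Suc p) else (k, p))"
    \<comment> \<open>The constrained positions \<open>J\<close> split into new top entries, indexed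
      by \<open>J0\<close>, and old entries, traced back to \<open>J1\<close>.\<close>
    define J0 where "J0 = {k \<in> V. (k, 0) \<in> J}"
    define J1 where "J1 = e -` J"
    have inj: "inj e" by (auto simp: e_def inj_def split: if_splits)
    have fst_e: "fst (e z) = fst z" for z by (auto simp: e_def split: prod.split)
    have W_e: "W (e z) = W z" for z using fst_e[of z] by (simp add: W_def case_prod_unfold)
    have "J0 \<subseteq> fst ` J" by (force simp: J0_def)
    then have fin: "finite J0" "finite J1"
      using J(1) inj by (auto simp: J1_def intro: finite_vimageI finite_subset)
    have J1I: "J1 \<subseteq> I"
    proof
      fix z assume "z \<in> J1"
      then have "e z \<in> I" using J(2) by (auto simp: J1_def)
      then show "z \<in> I" using fst_e[of z] by (auto simp: I_def mem_Times_iff)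
    qed
    have decomp: "J = (\<lambda>k. (k, 0)) ` J0 \<union> e ` J1"
    proof
      show "J \<subseteq> (\<lambda>k. (k, 0)) ` J0 \<union> e ` J1"
      proof
        fix z assume z: "z \<in> J"
        obtain k p where kp: "z = (k, p)" by force
        consider "k \<in> V" "p = 0" | q where "k \<in> V" "p = Suc q" | "k \<notin> V"
          by (cases p) auto
        then show "z \<in> (\<lambda>k. (k, 0)) ` J0 \<union> e ` J1"
        proof cases
          case 1 then show ?thesis using z kp by (auto simp: J0_def)
        next
          case 2
          then have "e (k, q) = z" by (simp add: kp e_def)
          then show ?thesis using z unfolding J1_def by blast
        next
          case 3
          then have "e (k, p) = z" by (simp add: kp e_def)
          then show ?thesis using z unfolding J1_def by blast
        qed
      qed
    qed (auto simp: J0_def J1_def)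
    define X0 where "X0 = {s \<in> space \<Omega>. \<forall>k\<in>J0. s k \<in> A (k, 0)}"
    define X1 where "X1 = {T \<in> space (tables n M). \<forall>z\<in>J1. T z \<in> A (e z)}"
    let ?E = "{T \<in> space (tables n M). \<forall>z\<in>J. T z \<in> A z}"
    have emb: "prod_emb I W J (Pi\<^sub>E J A) = ?E"
      using J(2) by (auto simp: prod_emb_def tab space_PiM PiE_iff extensional_def)
    have A0: "A (k, 0) \<in> sets (M k)" if "k \<in> J0" for k
      using A[of "(k, 0)"] that by (simp add: J0_def W_def)
    have A1: "A (e z) \<in> sets (W z)" if "z \<in> J1" for z
      using A[of "e z"] that by (simp add: J1_def W_e)
    have J0n: "J0 \<subseteq> {1..n}" using V by (auto simp: J0_def)
    have X0: "emeasure \<Omega> X0 = (\<Prod>k\<in>J0. emeasure (M k) (A (k, 0)))" "X0 \<in> sets \<Omega>"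
      unfolding X0_def assignments_def
      using prob_M fin(1) J0n A0 by (intro emeasure_box; auto)+
    have X1: "emeasure (tables n M) X1 = (\<Prod>z\<in>J1. emeasure (W z) (A (e z)))"
      "X1 \<in> sets (tables n M)"
      unfolding X1_def tab using prob_W fin(2) J1I A1 by (intro emeasure_box; auto)+
    have E: "emeasure (tables n M) ?E = (\<Prod>z\<in>J. emeasure (W z) (A z))" "?E \<in> sets (tables n M)"
      unfolding tab using prob_W J A by (intro emeasure_box; auto)+
    have "(\<lambda>(s, T). push V s T) -` ?E \<inter> space (\<Omega> \<Otimes>\<^sub>M tables n M) = X0 \<times> X1"
    proof -
      have iff: "push V s T \<in> ?E \<longleftrightarrow> s \<in> X0 \<and> T \<in> X1"
        if "s \<in> space \<Omega>" "T \<in> space (tables n M)" for s T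
      proof -
        have "push V s T (e z) = T z" for z
          by (cases z) (auto simp: push_def e_def)
        moreover have "push V s T (k, 0) = s k" if "k \<in> J0" for k
          using that by (simp add: J0_def push_top)
        moreover have "(\<forall>z\<in>J. push V s T z \<in> A z) \<longleftrightarrow>
          (\<forall>k\<in>J0. push V s T (k, 0) \<in> A (k, 0)) \<and> (\<forall>z\<in>J1. push V s T (e z) \<in> A (e z))"
          by (subst decomp) (simp add: ball_Un)
        ultimately show ?thesis using that push_in_space[OF V that] by (simp add: X0_def X1_def)
      qed
      show ?thesis
      proof (rule set_eqI)
        fix z :: "(nat \<Rightarrow> 'a) \<times> 'a table"
        obtain s T where z: "z = (s, T)" by force
        have "s \<in> X0 \<Longrightarrow> s \<in> space \<Omega>" "T \<in> X1 \<Longrightarrow> T \<in> space (tables n M)"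
          by (auto simp: X0_def X1_def)
        then show "z \<in> (\<lambda>(s, T). push V s T) -` ?E \<inter> space (\<Omega> \<Otimes>\<^sub>M tables n M) \<longleftrightarrow> z \<in> X0 \<times> X1"
          unfolding z using iff[of s T] by (auto simp: space_pair_measure simp del: mem_Collect_eq)
      qed
    qed
    then have "emeasure (distr (\<Omega> \<Otimes>\<^sub>M tables n M) (tables n M) (\<lambda>(s, T). push V s T)) ?E =
        emeasure (\<Omega> \<Otimes>\<^sub>M tables n M) (X0 \<times> X1)"
      using E(2) measurable_push[OF V] by (simp add: emeasure_distr)
    also have "\<dots> = emeasure \<Omega> X0 * emeasure (tables n M) X1"
      using X0(2) X1(2) by (rule tables.emeasure_pair_measure_Times)
    also have "\<dots> = (\<Prod>z\<in>(\<lambda>k. (k, 0)) ` J0. emeasure (W z) (A z)) * (\<Prod>z\<in>e ` J1. emeasure (W z) (A z))"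
      unfolding X0(1) X1(1)
      using inj_on_subset[OF inj subset_UNIV, of J1]
      by (simp add: prod.reindex inj_on_def W_e) (simp add: W_def)
    also have "\<dots> = (\<Prod>z\<in>(\<lambda>k. (k, 0)) ` J0 \<union> e ` J1. emeasure (W z) (A z))"
    proof (rule prod.union_disjoint[symmetric])
      show "(\<lambda>k. (k, 0)) ` J0 \<inter> e ` J1 = {}"
        by (auto simp: J0_def e_def split: if_splits)
    qed (use fin in auto)
    also have "\<dots> = (\<Prod>z\<in>J. emeasure (W z) (A z))" by (simp only: decomp[symmetric])
    finally show "emeasure (PiM I W) (prod_emb I W J (Pi\<^sub>E J A)) =
      emeasure (distr (\<Omega> \<Otimes>\<^sub>M tables n M) (tables n M) (\<lambda>(s, T). push V s T)) (prod_emb I W J (Pi\<^sub>E J A))"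
      unfolding emb using E(1) by (simp add: tab)
  qed (auto simp: tab[symmetric] intro: tables.finite_measure_axioms)
  then show ?thesis by (simp add: tab)
qed

text \<open>\<open>distr_push\<close> turns a question about a table into one about an independent
  pair. The factorisations of table events below rest on this.\<close>

lemma emeasure_push:
  assumes "V \<subseteq> {1..n}" "X \<in> sets \<Omega>" "Q \<in> sets (tables n M)" "Y \<in> sets (tables n M)"
    and "\<And>s T. s \<in> space \<Omega> \<Longrightarrow> T \<in> space (tables n M) \<Longrightarrow> push V s T \<in> Y \<longleftrightarrow> s \<in> X \<and> T \<in> Q"
  shows "emeasure (tables n M) Y = emeasure \<Omega> X * emeasure (tables n M) Q"
proof -
  have "(\<lambda>(s, T). push V s T) -` Y \<inter> space (\<Omega> \<Otimes>\<^sub>M tables n M) = X \<times> Q"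
    using assms(5) sets.sets_into_space[OF assms(2)] sets.sets_into_space[OF assms(3)]
    by (fastforce simp: space_pair_measure)
  then have "emeasure (distr (\<Omega> \<Otimes>\<^sub>M tables n M) (tables n M) (\<lambda>(s, T). push V s T)) Y =
      emeasure (\<Omega> \<Otimes>\<^sub>M tables n M) (X \<times> Q)"
    using assms(4) measurable_push[OF assms(1)] by (simp add: emeasure_distr)
  also have "\<dots> = emeasure \<Omega> X * emeasure (tables n M) Q"
    using assms(2,3) by (rule tables.emeasure_pair_measure_Times)
  finally show ?thesis by (simp add: distr_push[OF assms(1)])
qed

lemma top_row_push: "s \<in> space \<Omega> \<Longrightarrow> top_row n (push {1..n} s T) = s"
  by (auto simp: top_row_def push_top assignments_def space_PiM PiE_iff extensional_def fun_eq_iff)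

lemma sets_top_row: "X \<in> sets \<Omega> \<Longrightarrow> {T \<in> space (tables n M). top_row n T \<in> X} \<in> sets (tables n M)"
  using measurable_sets[OF measurable_top_row] by (simp add: vimage_def Int_def conj_commute)

lemma emeasure_top_row:
  assumes "X \<in> sets \<Omega>"
  shows "emeasure (tables n M) {T \<in> space (tables n M). top_row n T \<in> X} = emeasure \<Omega> X"
proof -
  have "emeasure (tables n M) {T \<in> space (tables n M). top_row n T \<in> X} =
      emeasure \<Omega> X * emeasure (tables n M) (space (tables n M))"
    using assms
    by (intro emeasure_push[of "{1..n}"])
      (auto simp: top_row_push simp del: One_nat_def intro: sets_top_row push_in_space)
  then show ?thesis by (simp add: tables.emeasure_space_1)
qed

lemma sets_row_entry:
  assumes "X \<in> sets \<Omega>" "i \<in> {1..n}" "D \<in> sets (M i)"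
  shows "{T \<in> space (tables n M). top_row n T \<in> X \<and> T (i, p) \<in> D} \<in> sets (tables n M)"
proof -
  have "{T \<in> space (tables n M). top_row n T \<in> X \<and> T (i, p) \<in> D} =
    {T \<in> space (tables n M). top_row n T \<in> X} \<inter> ((\<lambda>T. T (i, p)) -` D \<inter> space (tables n M))"
    by auto
  then show ?thesis
    using sets_top_row[OF assms(1)] measurable_sets[OF measurable_table_entry[OF assms(2)] assms(3)]
    by simp
qed

text \<open>Pushing a full row moves entry \<open>(i, 0)\<close> of the remaining table to
  \<open>(i, 1)\<close>, so the value that replaces \<open>X(i)\<close> is independent of row 0.
  This yields the factor Pr(A) in front of the sum.\<close>

lemma emeasure_row_then_entry:
  assumes "X \<in> sets \<Omega>" "i \<in> {1..n}" "D \<in> sets (M i)"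
  shows "emeasure (tables n M) {T \<in> space (tables n M). top_row n T \<in> X \<and> T (i, 1) \<in> D} =
    emeasure \<Omega> X * emeasure \<Omega> {x \<in> space \<Omega>. x i \<in> D}"
proof -
  have A: "{x \<in> space \<Omega>. x i \<in> D} \<in> sets \<Omega>"
    using measurable_sets[OF measurable_coord[OF assms(2)] assms(3)]
    by (simp add: vimage_def Int_def conj_commute)
  have "emeasure (tables n M) {T \<in> space (tables n M). top_row n T \<in> X \<and> T (i, 1) \<in> D} =
    emeasure \<Omega> X * emeasure (tables n M)
      {T \<in> space (tables n M). top_row n T \<in> {x \<in> space \<Omega>. x i \<in> D}}"
  proof (rule emeasure_push[of "{1..n}"])
    show "{T \<in> space (tables n M). top_row n T \<in> X \<and> T (i, 1) \<in> D} \<in> sets (tables n M)"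
      by (rule sets_row_entry[OF assms])
    fix s T assume sT: "s \<in> space \<Omega>" "T \<in> space (tables n M)"
    have "push {1..n} s T (i, 1) = T (i, 0)" using assms(2) by (simp add: push_def)
    moreover have "top_row n T i = T (i, 0)" using assms(2) by (simp add: top_row_def)
    ultimately show "push {1..n} s T \<in> {T \<in> space (tables n M). top_row n T \<in> X \<and> T (i, 1) \<in> D} \<longleftrightarrow>
      s \<in> X \<and> T \<in> {T \<in> space (tables n M). top_row n T \<in> {x \<in> space \<Omega>. x i \<in> D}}"
      using sT push_in_space[OF _ sT, of "{1..n}"] top_row_in_space[OF sT(2)]
      by (simp add: top_row_push del: One_nat_def)
  qed (use assms(1) sets_top_row[OF A] in auto)
  then show ?thesis by (simp only: emeasure_top_row[OF A])
qed

end

section \<open>Probability that a chain is consistent\<close>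

locale bad_events = variable_setting + event_family
begin

lemma sets_holds: "B \<in> \<B> \<Longrightarrow> holds B \<in> sets \<Omega>"
  using events by (simp add: is_event_def)

lemma sets_shift:
  "Q \<in> sets (tables n M) \<Longrightarrow> {T \<in> space (tables n M). shift V T \<in> Q} \<in> sets (tables n M)"
  using measurable_sets[OF measurable_shift] by (simp add: vimage_def Int_def conj_commute)

lemma sets_layer:
  assumes "finite J" "J \<subseteq> \<B>" "Q \<in> sets (tables n M)"
  shows "{T \<in> space (tables n M). (\<forall>B\<in>J. top_row n T \<in> holds B) \<and> shift (vars J) T \<in> Q}
    \<in> sets (tables n M)"
proof (rule sets.sets_Collect_conj)
  show "{T \<in> space (tables n M). \<forall>B\<in>J. top_row n T \<in> holds B} \<in> sets (tables n M)"
    using assms by (intro sets.sets_Collect_finite_All sets_top_row sets_holds) auto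
qed (rule sets_shift[OF assms(3)])

text \<open>Events are peeled off one at a time: a push on \<open>var B\<close> decides
  \<open>B\<close> by the fresh values alone and leaves the columns read by the other members
  unchanged.\<close>

lemma emeasure_layer:
  assumes "finite J" "J \<subseteq> \<B>" "stable J" and Q: "Q \<in> sets (tables n M)"
  shows "emeasure (tables n M)
      {T \<in> space (tables n M). (\<forall>B\<in>J. top_row n T \<in> holds B) \<and> shift (vars J) T \<in> Q} =
    ennreal (weight \<Omega> J) * emeasure (tables n M) Q"
  using assms(1-3)
proof (induction J rule: finite_induct)
  case empty
  have "{T \<in> space (tables n M). T \<in> Q} = Q" using sets.sets_into_space[OF Q] by blast
  then show ?case by (simp add: weight_def)
next
  case (insert B J)
  let ?Q = "{T \<in> space (tables n M). (\<forall>B\<in>J. top_row n T \<in> holds B) \<and> shift (vars J) T \<in> Q}"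
  let ?Y = "{T \<in> space (tables n M). (\<forall>B\<in>insert B J. top_row n T \<in> holds B) \<and>
    shift (vars (insert B J)) T \<in> Q}"
  have B: "B \<in> \<B>" and J: "J \<subseteq> \<B>" using insert.prems(1) by auto
  have var: "var B \<subseteq> {1..n}" by (rule var_subset[OF B])
  have stJ: "stable J" using insert.prems(2) unfolding stable_def by (rule pairwise_subset) blast
  have disj: "var B \<inter> var B' = {}" if "B' \<in> J" for B'
    using insert.prems(2) insert.hyps(2) that
    by (auto simp: stable_def pairwise_def dependent_events_def)
  have "emeasure (tables n M) ?Y = emeasure \<Omega> (holds B) * emeasure (tables n M) ?Q"
  proof (rule emeasure_push[OF var])
    show "?Y \<in> sets (tables n M)"
      using insert.hyps(1) insert.prems(1) Q by (intro sets_layer) auto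
    show "?Q \<in> sets (tables n M)"
      using insert.hyps(1) J Q by (rule sets_layer)
    fix s T assume sT: "s \<in> space \<Omega>" "T \<in> space (tables n M)"
    note ps = push_in_space[OF var sT]
    have "top_row n (push (var B) s T) \<in> holds B \<longleftrightarrow> s \<in> holds B"
      using var by (intro holds_cong[OF B top_row_in_space[OF ps] sT(1)])
        (auto simp: top_row_def push_top)
    moreover have "top_row n (push (var B) s T) \<in> holds B' \<longleftrightarrow> top_row n T \<in> holds B'"
      if "B' \<in> J" for B'
      using disj[OF that] J that
      by (intro top_row_cong[OF _ ps sT(2)]) (auto simp: push_def)
    moreover have "shift (vars (insert B J)) (push (var B) s T) = shift (vars J) T"
    proof -
      have "var B \<inter> vars J = {}" using disj by blast
      then show ?thesis by (simp add: shift_Un)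
    qed
    ultimately show "push (var B) s T \<in> ?Y \<longleftrightarrow> s \<in> holds B \<and> T \<in> ?Q"
      using ps sT by auto
  qed (rule sets_holds[OF B])
  also have "\<dots> = emeasure \<Omega> (holds B) * (ennreal (weight \<Omega> J) * emeasure (tables n M) Q)"
    by (simp only: insert.IH[OF J stJ])
  also have "\<dots> = ennreal (weight \<Omega> (insert B J)) * emeasure (tables n M) Q"
    using insert.hyps weight_nonneg[of \<Omega> J]
    by (simp add: \<Omega>.emeasure_eq_measure weight_def ennreal_mult mult.assoc prod_nonneg)
  finally show ?case .
qed

text \<open>The head is tested last, so its requirement is absorbed into the event \<open>Q\<close>
  for the tail and evaluated by \<open>emeasure_layer\<close>. The freedom in \<open>Q\<close>
  expresses that the chain leaves a fresh table behind.\<close>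

lemma emeasure_chain:
  assumes "\<C> \<subseteq> \<B>" "Js \<in> chains \<C> L S" "Q \<in> sets (tables n M)"
  shows "{T \<in> space (tables n M). consistent n Js T \<and> unwind Js T \<in> Q} \<in> sets (tables n M) \<and>
    emeasure (tables n M) {T \<in> space (tables n M). consistent n Js T \<and> unwind Js T \<in> Q} =
    ennreal (\<Prod>J\<leftarrow>Js. weight \<Omega> J) * emeasure (tables n M) Q"
  using assms(2,3)
proof (induction L arbitrary: Js S Q)
  case 0
  have "{T \<in> space (tables n M). T \<in> Q} = Q" using sets.sets_into_space[OF 0(2)] by blast
  then show ?case using 0 by simp
next
  case (Suc L)
  then obtain J Ks where Js: "Js = J # Ks" and J: "J \<subseteq> touching \<C> S" "stable J"
    and Ks: "Ks \<in> chains \<C> L (vars J)" by auto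
  have JB: "J \<subseteq> \<B>" using J(1) assms(1) by (auto simp: touching_def)
  then have fin: "finite J" using finite_family by (rule finite_subset)
  let ?Q = "{T \<in> space (tables n M). (\<forall>B\<in>J. top_row n T \<in> holds B) \<and> shift (vars J) T \<in> Q}"
  have eq: "{T \<in> space (tables n M). consistent n Js T \<and> unwind Js T \<in> Q} =
    {T \<in> space (tables n M). consistent n Ks T \<and> unwind Ks T \<in> ?Q}"
    using Js by (auto intro: unwind_in_space)
  have Q: "?Q \<in> sets (tables n M)" using fin JB Suc.prems(2) by (rule sets_layer)
  have "(\<Prod>J\<leftarrow>Ks. weight \<Omega> J) \<ge> 0" by (rule prod_list_nonneg) (auto simp: weight_nonneg)
  then have "ennreal (\<Prod>J\<leftarrow>Ks. weight \<Omega> J) * emeasure (tables n M) ?Q =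
    ennreal (\<Prod>J\<leftarrow>Js. weight \<Omega> J) * emeasure (tables n M) Q"
    unfolding emeasure_layer[OF fin JB J(2) Suc.prems(2)]
    using weight_nonneg[of \<Omega> J] by (simp add: Js ennreal_mult ac_simps)
  then show ?case unfolding eq using Suc.IH[OF Ks Q] by simp
qed

end

section \<open>Runs of the algorithm\<close>

primrec run ::
  "('s \<Rightarrow> nat \<Rightarrow> 'a) \<Rightarrow> (nat set \<Rightarrow> 's \<Rightarrow> 's) \<Rightarrow> 'a event set \<Rightarrow>
    ((nat \<Rightarrow> 'a) list \<Rightarrow> 'a event) \<Rightarrow> nat \<Rightarrow> (nat \<Rightarrow> 'a) list \<Rightarrow> 's \<Rightarrow> (nat \<Rightarrow> 'a) list" where
  "run obs advance \<B> f 0 h \<sigma> = h"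
| "run obs advance \<B> f (Suc t) h \<sigma> =
     (if \<exists>B\<in>\<B>. last h \<in> holds B
      then run obs advance \<B> f t (h @ [override_on (last h) (obs \<sigma>) (var (f h))]) (advance (var (f h)) \<sigma>)
      else h)"

text \<open>Fresh values are integrated out step by step, so no source occurs. The two sources are
  compared through this common value.\<close>

primrec run_prob ::
  "(nat \<Rightarrow> 'a) measure \<Rightarrow> 'a event set \<Rightarrow> ((nat \<Rightarrow> 'a) list \<Rightarrow> 'a event) \<Rightarrow>
    (nat \<Rightarrow> 'a) set \<Rightarrow> nat \<Rightarrow> (nat \<Rightarrow> 'a) list \<Rightarrow> ennreal" where
  "run_prob \<Omega> \<B> f G 0 h = indicator G (last h)"
| "run_prob \<Omega> \<B> f G (Suc t) h =
     (if \<exists>B\<in>\<B>. last h \<in> holds B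
      then \<integral>\<^sup>+ s. run_prob \<Omega> \<B> f G t (h @ [override_on (last h) s (var (f h))]) \<partial>\<Omega>
      else indicator G (last h))"

lemma (in variable_setting) override_on_in_space:
  "x \<in> space \<Omega> \<Longrightarrow> s \<in> space \<Omega> \<Longrightarrow> override_on x s V \<in> space \<Omega>"
  by (auto simp: assignments_def space_PiM PiE_iff override_on_def extensional_def)

lemma (in variable_setting) measurable_override_on:
  assumes "a \<in> N \<rightarrow>\<^sub>M \<Omega>" "b \<in> N \<rightarrow>\<^sub>M \<Omega>"
  shows "(\<lambda>q. override_on (a q) (b q) V) \<in> N \<rightarrow>\<^sub>M \<Omega>"
proof -
  have "(\<lambda>q k. override_on (a q) (b q) V k) \<in> N \<rightarrow>\<^sub>M PiM {1..n} M"
  proof (rule measurable_PiM_single')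
    fix k assume k: "k \<in> {1..n}"
    show "(\<lambda>q. override_on (a q) (b q) V k) \<in> N \<rightarrow>\<^sub>M M k"
    proof (cases "k \<in> V")
      case True
      show ?thesis unfolding override_on_apply_in[OF True]
        using assms(2) measurable_coord[OF k] by (rule measurable_compose)
    next
      case False
      show ?thesis unfolding override_on_apply_notin[OF False]
        using assms(1) measurable_coord[OF k] by (rule measurable_compose)
    qed
  next
    have "override_on (a q) (b q) V \<in> space \<Omega>" if "q \<in> space N" for q
      by (rule override_on_in_space[OF measurable_space[OF assms(1) that] measurable_space[OF assms(2) that]])
    then show "(\<lambda>q k. override_on (a q) (b q) V k) \<in> space N \<rightarrow> (\<Pi>\<^sub>E k\<in>{1..n}. space (M k))"
      unfolding assignments_def space_PiM by (rule Pi_I)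
  qed
  then show ?thesis unfolding assignments_def by this
qed

text \<open>
  Both the stream of samples in \<open>mt_prob\<close> and the resampling table supply fresh values for the
  variables in \<open>V\<close> that are independent of what remains, which is again distributed as before.
  This alone determines the law of a run, hence the two agree.
\<close>

locale sample_source = bad_events +
  fixes \<Sigma> :: "'s measure" and obs :: "'s \<Rightarrow> nat \<Rightarrow> 'a" and advance :: "nat set \<Rightarrow> 's \<Rightarrow> 's"
    and prepend :: "nat set \<Rightarrow> (nat \<Rightarrow> 'a) \<Rightarrow> 's \<Rightarrow> 's"
  assumes prob_source: "prob_space \<Sigma>"
    and measurable_obs: "obs \<in> \<Sigma> \<rightarrow>\<^sub>M \<Omega>"
    and measurable_advance: "V \<subseteq> {1..n} \<Longrightarrow> advance V \<in> \<Sigma> \<rightarrow>\<^sub>M \<Sigma>"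
    and measurable_prepend: "V \<subseteq> {1..n} \<Longrightarrow> (\<lambda>(s, \<sigma>). prepend V s \<sigma>) \<in> \<Omega> \<Otimes>\<^sub>M \<Sigma> \<rightarrow>\<^sub>M \<Sigma>"
    and distr_prepend: "V \<subseteq> {1..n} \<Longrightarrow> distr (\<Omega> \<Otimes>\<^sub>M \<Sigma>) \<Sigma> (\<lambda>(s, \<sigma>). prepend V s \<sigma>) = \<Sigma>"
    and advance_prepend: "advance V (prepend V s \<sigma>) = \<sigma>"
    and obs_prepend: "V \<subseteq> {1..n} \<Longrightarrow> k \<in> V \<Longrightarrow> obs (prepend V s \<sigma>) k = s k"
begin

text \<open>The history is a function on \<open>{..m}\<close> because measurability of the rule is
  assumed in that form. As the resampled variables depend on the selection, each step is split over
  the finitely many events that can be selected.\<close>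

lemma sets_run:
  assumes sel: "selection_rule \<Omega> \<B> R sel" and r: "r \<in> Q \<rightarrow>\<^sub>M R" and G: "G \<in> sets \<Omega>"
    and "z \<in> Q \<rightarrow>\<^sub>M PiM {..m} (\<lambda>_. \<Omega>)" "\<sigma> \<in> Q \<rightarrow>\<^sub>M \<Sigma>"
  shows "{q \<in> space Q. last (run obs advance \<B> (sel (r q)) t (map (z q) [0..<Suc m]) (\<sigma> q)) \<in> G}
    \<in> sets Q"
  using assms(4,5)
proof (induction t arbitrary: m z \<sigma>)
  case 0
  have "(\<lambda>q. z q m) \<in> Q \<rightarrow>\<^sub>M \<Omega>"
    using measurable_compose[OF 0(1) measurable_component_singleton[of m]] by simp
  then have "(\<lambda>q. z q m) -` G \<inter> space Q \<in> sets Q" using G by (rule measurable_sets)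
  then show ?case by (simp add: vimage_def Int_def conj_commute)
next
  case (Suc t)
  let ?h = "\<lambda>q. map (z q) [0..<Suc m]"
  have zm: "(\<lambda>q. z q m) \<in> Q \<rightarrow>\<^sub>M \<Omega>"
    using measurable_compose[OF Suc.prems(1) measurable_component_singleton[of m]] by simp
  have zS: "{q \<in> space Q. z q m \<in> X} \<in> sets Q" if "X \<in> sets \<Omega>" for X
    using measurable_sets[OF zm that] by (simp add: vimage_def Int_def conj_commute)
  have bad: "{q \<in> space Q. \<exists>B\<in>\<B>. z q m \<in> holds B} \<in> sets Q"
    using finite_family by (intro sets.sets_Collect_finite_Ex zS sets_holds)
  have selB: "{q \<in> space Q. sel (r q) (?h q) = B} \<in> sets Q" for B
  proof -
    have "(\<lambda>(r, x). sel r (map x [0..<Suc m])) \<in> R \<Otimes>\<^sub>M PiM {..m} (\<lambda>_. \<Omega>) \<rightarrow>\<^sub>M count_space UNIV"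
      using sel by (simp add: selection_rule_def)
    from measurable_compose[OF measurable_Pair[OF r Suc.prems(1)] this]
    have "(\<lambda>q. sel (r q) (?h q)) \<in> Q \<rightarrow>\<^sub>M count_space UNIV" by simp
    from measurable_sets[OF this, of "{B}"] show ?thesis
      by (simp add: vimage_def Int_def conj_commute)
  qed
  \<comment> \<open>The history extended by a resampling of \<open>B\<close>, for every candidate
    \<open>B\<close> regardless of the actual selection.\<close>
  define z' where "z' B q = (z q)(Suc m := override_on (z q m) (obs (\<sigma> q)) (var B))" for B :: "'a event" and q
  have h': "map (z' B q) [0..<Suc (Suc m)] = ?h q @ [override_on (z q m) (obs (\<sigma> q)) (var B)]" for B q
    by (simp add: z'_def)
  let ?S = "\<lambda>B. {q \<in> space Q.
    last (run obs advance \<B> (sel (r q)) t (map (z' B q) [0..<Suc (Suc m)]) (advance (var B) (\<sigma> q))) \<in> G}"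
  have S: "?S B \<in> sets Q" if "B \<in> \<B>" for B
  proof (rule Suc.IH)
    show "z' B \<in> Q \<rightarrow>\<^sub>M PiM {..Suc m} (\<lambda>_. \<Omega>)"
      unfolding z'_def[abs_def]
    proof (rule measurable_fun_upd[OF _ Suc.prems(1)])
      show "(\<lambda>q. override_on (z q m) (obs (\<sigma> q)) (var B)) \<in> Q \<rightarrow>\<^sub>M \<Omega>"
        using zm measurable_compose[OF Suc.prems(2) measurable_obs] by (rule measurable_override_on)
    qed auto
    show "(\<lambda>q. advance (var B) (\<sigma> q)) \<in> Q \<rightarrow>\<^sub>M \<Sigma>"
      using Suc.prems(2) measurable_advance[OF var_subset[OF that]] by (rule measurable_compose)
  qed
  have selq: "sel (r q) (?h q) \<in> \<B>" if "q \<in> space Q" "\<exists>B\<in>\<B>. z q m \<in> holds B" for q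
  proof -
    have "r q \<in> space R" using r that(1) by (rule measurable_space)
    moreover have "z q \<in> space (PiM {..m} (\<lambda>_. \<Omega>))"
      using Suc.prems(1) that(1) by (rule measurable_space)
    then have "set (?h q) \<subseteq> space \<Omega>" by (auto simp: space_PiM less_Suc_eq_le)
    moreover have "?h q \<noteq> []" "last (?h q) = z q m" by simp_all
    ultimately show ?thesis using sel that(2) unfolding selection_rule_def by metis
  qed
  have "{q \<in> space Q. last (run obs advance \<B> (sel (r q)) (Suc t) (?h q) (\<sigma> q)) \<in> G} =
    ({q \<in> space Q. z q m \<in> G} - {q \<in> space Q. \<exists>B\<in>\<B>. z q m \<in> holds B}) \<union>
    (\<Union>B\<in>\<B>. {q \<in> space Q. \<exists>B\<in>\<B>. z q m \<in> holds B} \<inter> {q \<in> space Q. sel (r q) (?h q) = B} \<inter> ?S B)"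
    (is "?L = ?U")
  proof (rule set_eqI)
    fix q
    have last: "last (?h q) = z q m" by simp
    show "q \<in> ?L \<longleftrightarrow> q \<in> ?U"
    proof (cases "\<exists>B\<in>\<B>. z q m \<in> holds B")
      case True
      then show ?thesis
        using selq[of q] unfolding run.simps last h' by auto
    next
      case False
      then show ?thesis unfolding run.simps last by auto
    qed
  qed
  also have "\<dots> \<in> sets Q"
    using bad selB S zS[OF G] finite_family by (intro sets.Un sets.Diff sets.finite_UN sets.Int)
  finally show ?case .
qed

lemma sets_run_fixed:
  assumes sel: "selection_rule \<Omega> \<B> R sel" and r: "r \<in> space R" and G: "G \<in> sets \<Omega>"
    and h: "h \<noteq> []" "set h \<subseteq> space \<Omega>"
  shows "{\<sigma> \<in> space \<Sigma>. last (run obs advance \<B> (sel r) t h \<sigma>) \<in> G} \<in> sets \<Sigma>"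
proof -
  obtain m where m: "length h = Suc m" using h(1) by (cases h) auto
  have "(\<lambda>k\<in>{..m}. h ! k) \<in> space (PiM {..m} (\<lambda>_. \<Omega>))"
    using h(2) m nth_mem[of _ h] by (auto simp: space_PiM)
  then have "(\<lambda>_. \<lambda>k\<in>{..m}. h ! k) \<in> \<Sigma> \<rightarrow>\<^sub>M PiM {..m} (\<lambda>_. \<Omega>)" by (rule measurable_const)
  moreover have "map (\<lambda>k\<in>{..m}. h ! k) [0..<Suc m] = h"
    using m by (intro nth_equalityI) (auto simp: less_Suc_eq_le simp del: upt_Suc)
  ultimately show ?thesis
    using sets_run[OF sel measurable_const[OF r] G, of "\<lambda>_. \<lambda>k\<in>{..m}. h ! k" \<Sigma> m "\<lambda>\<sigma>. \<sigma>" t]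
    by (simp del: upt_Suc)
qed

lemma emeasure_prepend:
  assumes "V \<subseteq> {1..n}" "Y \<in> sets \<Sigma>"
  shows "emeasure \<Sigma> Y = (\<integral>\<^sup>+ s. emeasure \<Sigma> {\<sigma> \<in> space \<Sigma>. prepend V s \<sigma> \<in> Y} \<partial>\<Omega>)"
proof -
  interpret \<Sigma>: prob_space \<Sigma> by (rule prob_source)
  let ?P = "(\<lambda>(s, \<sigma>). prepend V s \<sigma>) -` Y \<inter> space (\<Omega> \<Otimes>\<^sub>M \<Sigma>)"
  have "emeasure \<Sigma> Y = emeasure (distr (\<Omega> \<Otimes>\<^sub>M \<Sigma>) \<Sigma> (\<lambda>(s, \<sigma>). prepend V s \<sigma>)) Y"
    by (simp only: distr_prepend[OF assms(1)])
  also have "\<dots> = emeasure (\<Omega> \<Otimes>\<^sub>M \<Sigma>) ?P"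
    using measurable_prepend[OF assms(1)] assms(2) by (rule emeasure_distr)
  also have "\<dots> = (\<integral>\<^sup>+ s. emeasure \<Sigma> (Pair s -` ?P) \<partial>\<Omega>)"
    using measurable_sets[OF measurable_prepend[OF assms(1)] assms(2)]
    by (rule \<Sigma>.emeasure_pair_measure_alt)
  also have "\<dots> = (\<integral>\<^sup>+ s. emeasure \<Sigma> {\<sigma> \<in> space \<Sigma>. prepend V s \<sigma> \<in> Y} \<partial>\<Omega>)"
    by (intro nn_integral_cong arg_cong[where f = "emeasure \<Sigma>"]) (auto simp: space_pair_measure)
  finally show ?thesis .
qed

lemma prepend_in_space:
  assumes "V \<subseteq> {1..n}" "s \<in> space \<Omega>" "\<sigma> \<in> space \<Sigma>"
  shows "prepend V s \<sigma> \<in> space \<Sigma>"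
  using measurable_space[OF measurable_prepend[OF assms(1)], of "(s, \<sigma>)"] assms
  by (simp add: space_pair_measure)

text \<open>After conditioning on the new values by \<open>emeasure_prepend\<close>, the run
  continues from a longer history with a source of the same law.\<close>

lemma emeasure_run:
  assumes sel: "selection_rule \<Omega> \<B> R sel" and r: "r \<in> space R" and G: "G \<in> sets \<Omega>"
    and "h \<noteq> []" "set h \<subseteq> space \<Omega>"
  shows "emeasure \<Sigma> {\<sigma> \<in> space \<Sigma>. last (run obs advance \<B> (sel r) t h \<sigma>) \<in> G} =
    run_prob \<Omega> \<B> (sel r) G t h"
  using assms(4,5)
proof (induction t arbitrary: h)
  interpret \<Sigma>: prob_space \<Sigma> by (rule prob_source)
  have const: "emeasure \<Sigma> {\<sigma> \<in> space \<Sigma>. P} = (if P then 1 else 0)" for P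
    using \<Sigma>.emeasure_space_1 by simp
  {
    case 0
    then show ?case by (simp add: const indicator_def)
  next
    case (Suc t)
    show ?case
    proof (cases "\<exists>B\<in>\<B>. last h \<in> holds B")
      case False
      then show ?thesis by (simp add: const indicator_def)
    next
      case True
      then have "sel r h \<in> \<B>"
        using sel r Suc.prems by (auto simp: selection_rule_def)
      then have V: "var (sel r h) \<subseteq> {1..n}" by (rule var_subset)
      let ?V = "var (sel r h)"
      have last: "last h \<in> space \<Omega>" using Suc.prems by auto
      have "emeasure \<Sigma> {\<sigma> \<in> space \<Sigma>. last (run obs advance \<B> (sel r) (Suc t) h \<sigma>) \<in> G} =
        (\<integral>\<^sup>+ s. emeasure \<Sigma> {\<sigma> \<in> space \<Sigma>.
          prepend ?V s \<sigma> \<in> {\<sigma> \<in> space \<Sigma>. last (run obs advance \<B> (sel r) (Suc t) h \<sigma>) \<in> G}} \<partial>\<Omega>)"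
        by (rule emeasure_prepend[OF V sets_run_fixed[OF sel r G Suc.prems]])
      also have "\<dots> = (\<integral>\<^sup>+ s. run_prob \<Omega> \<B> (sel r) G t (h @ [override_on (last h) s ?V]) \<partial>\<Omega>)"
      proof (rule nn_integral_cong)
        fix s assume s: "s \<in> space \<Omega>"
        \<comment> \<open>\<open>obs_prepend\<close> determines the observed values only on the
          resampled variables, and \<open>override_on\<close> reads no others.\<close>
        have "override_on (last h) (obs (prepend ?V s \<sigma>)) ?V = override_on (last h) s ?V" for \<sigma>
          using obs_prepend[OF V] by (auto simp: override_on_def)
        then have "{\<sigma> \<in> space \<Sigma>.
            prepend ?V s \<sigma> \<in> {\<sigma> \<in> space \<Sigma>. last (run obs advance \<B> (sel r) (Suc t) h \<sigma>) \<in> G}} =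
          {\<sigma> \<in> space \<Sigma>. last (run obs advance \<B> (sel r) t (h @ [override_on (last h) s ?V]) \<sigma>) \<in> G}"
          using True prepend_in_space[OF V s] by (simp add: advance_prepend cong: conj_cong)
        then show "emeasure \<Sigma> {\<sigma> \<in> space \<Sigma>.
            prepend ?V s \<sigma> \<in> {\<sigma> \<in> space \<Sigma>. last (run obs advance \<B> (sel r) (Suc t) h \<sigma>) \<in> G}} =
          run_prob \<Omega> \<B> (sel r) G t (h @ [override_on (last h) s ?V])"
          using Suc.IH[of "h @ [override_on (last h) s ?V]"] Suc.prems(2)
            override_on_in_space[OF last s] by simp
      qed
      finally show ?thesis using True by simp
    qed
  }
qed

lemma sets_run_start:
  assumes "selection_rule \<Omega> \<B> R sel" "r \<in> Q \<rightarrow>\<^sub>M R" "G \<in> sets \<Omega>" "\<sigma> \<in> Q \<rightarrow>\<^sub>M \<Sigma>"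
  shows "{q \<in> space Q. last (run obs advance \<B> (sel (r q)) t [obs (\<sigma> q)] (advance {1..n} (\<sigma> q))) \<in> G} \<in> sets Q"
proof -
  have "(\<lambda>q. \<lambda>_\<in>{..0}. obs (\<sigma> q)) \<in> Q \<rightarrow>\<^sub>M PiM {..0::nat} (\<lambda>_. \<Omega>)"
    by (intro measurable_restrict measurable_compose[OF assms(4) measurable_obs])
  from sets_run[OF assms(1-3) this measurable_compose[OF assms(4) measurable_advance[OF order_refl]], of t]
  show ?thesis by simp
qed

text \<open>The initial assignment is handled as a resampling of all variables. The right-hand side
  is the same for every source.\<close>

lemma emeasure_run_start:
  assumes sel: "selection_rule \<Omega> \<B> R sel" and r: "r \<in> space R" and G: "G \<in> sets \<Omega>"
  shows "emeasure \<Sigma> {\<sigma> \<in> space \<Sigma>. last (run obs advance \<B> (sel r) t [obs \<sigma>] (advance {1..n} \<sigma>)) \<in> G} =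
    (\<integral>\<^sup>+ s. run_prob \<Omega> \<B> (sel r) G t [s] \<partial>\<Omega>)" (is "emeasure \<Sigma> ?Y = _")
proof -
  have "?Y \<in> sets \<Sigma>"
    using sets_run_start[OF sel measurable_const[OF r] G, of "\<lambda>\<sigma>. \<sigma>" \<Sigma> t] by simp
  then have "emeasure \<Sigma> ?Y = (\<integral>\<^sup>+ s. emeasure \<Sigma> {\<sigma> \<in> space \<Sigma>. prepend {1..n} s \<sigma> \<in> ?Y} \<partial>\<Omega>)"
    by (rule emeasure_prepend[OF order_refl])
  also have "\<dots> = (\<integral>\<^sup>+ s. run_prob \<Omega> \<B> (sel r) G t [s] \<partial>\<Omega>)"
  proof (rule nn_integral_cong)
    fix s assume s: "s \<in> space \<Omega>"
    have obs: "obs (prepend {1..n} s \<sigma>) = s" if "\<sigma> \<in> space \<Sigma>" for \<sigma>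
    proof -
      have "obs (prepend {1..n} s \<sigma>) \<in> space \<Omega>"
        using measurable_obs prepend_in_space[OF order_refl s that] by (rule measurable_space)
      then show ?thesis
        using s obs_prepend[OF order_refl, of _ s \<sigma>]
        unfolding assignments_def space_PiM by (intro PiE_ext)
    qed
    have "{\<sigma> \<in> space \<Sigma>. prepend {1..n} s \<sigma> \<in> ?Y} =
      {\<sigma> \<in> space \<Sigma>. last (run obs advance \<B> (sel r) t [s] \<sigma>) \<in> G}"
      using prepend_in_space[OF order_refl s] obs by (auto simp: advance_prepend simp del: One_nat_def)
    then show "emeasure \<Sigma> {\<sigma> \<in> space \<Sigma>. prepend {1..n} s \<sigma> \<in> ?Y} = run_prob \<Omega> \<B> (sel r) G t [s]"
      using emeasure_run[OF sel r G, of "[s]" t] s by simp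
  qed
  finally show ?thesis .
qed

end

section \<open>Tables and sample streams as sources\<close>

context bad_events
begin

lemma table_source: "sample_source n M \<B> (tables n M) (top_row n) shift push"
proof
  show "V \<subseteq> {1..n} \<Longrightarrow> k \<in> V \<Longrightarrow> top_row n (push V s T) k = s k"
    for V k s and T :: "'a table"
    by (auto simp: top_row_def push_top)
qed (auto intro: measurable_top_row measurable_shift measurable_push distr_push simp del: One_nat_def)

text \<open>A whole sample is spent on each resampling, whatever \<open>V\<close> is.
  \<open>S.PiM_iter\<close> gives invariance of the law under prepending a sample.\<close>

lemma stream_source:
  "sample_source n M \<B> (PiM UNIV (\<lambda>_. \<Omega>)) (\<lambda>y. y 0) (\<lambda>_ y k. y (Suc k)) (\<lambda>_. case_nat)"
proof -
  interpret S: sequence_space \<Omega> ..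
  show ?thesis
  proof
    show "(\<lambda>y k. y (Suc k)) \<in> PiM UNIV (\<lambda>_. \<Omega>) \<rightarrow>\<^sub>M PiM UNIV (\<lambda>_. \<Omega>)"
      by (intro measurable_PiM_single') (auto simp: space_PiM)
  qed (auto simp: S.PiM_iter S.P.emeasure_space_1)
qed

end

lemma run_stopped:
  "\<not> (\<exists>B\<in>\<B>. last h \<in> holds B) \<Longrightarrow> run obs advance \<B> f t h \<sigma> = h"
  by (cases t) auto

text \<open>\<open>run\<close> recurses on its first step, whereas \<open>mt_history\<close> adds
  its newest step at the end; this bridges the two.\<close>

lemma stream_run_Suc:
  "run (\<lambda>y. y 0) (\<lambda>_ y k. y (Suc k)) \<B> f (Suc t) h y =
    (let h' = run (\<lambda>y. y 0) (\<lambda>_ y k. y (Suc k)) \<B> f t h y in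
      if \<exists>B\<in>\<B>. last h' \<in> holds B
      then h' @ [override_on (last h') (y t) (var (f h'))] else h')"
proof (induction t arbitrary: h y)
  case (Suc t)
  show ?case
  proof (cases "\<exists>B\<in>\<B>. last h \<in> holds B")
    case True
    then have step: "run (\<lambda>y. y 0) (\<lambda>_ y k. y (Suc k)) \<B> f (Suc u) h y =
      run (\<lambda>y. y 0) (\<lambda>_ y k. y (Suc k)) \<B> f u
        (h @ [override_on (last h) (y 0) (var (f h))]) (\<lambda>k. y (Suc k))" for u
      by simp
    show ?thesis unfolding step by (rule Suc.IH)
  next
    case False
    then show ?thesis by (simp add: run_stopped del: run.simps)
  qed
qed simp

lemma mt_history_run:
  "mt_history \<B> sel r y t =
    run (\<lambda>y. y 0) (\<lambda>_ y k. y (Suc k)) \<B> (sel r) t [y 0] (\<lambda>k. y (Suc k))"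
proof (induction t)
  case (Suc t)
  show ?case unfolding stream_run_Suc mt_history.simps Suc.IH by (rule refl)
qed simp

section \<open>The run on a resampling table\<close>

context bad_events
begin

text \<open>While variable \<open>i\<close> lies outside \<open>D\<close>, the last hypothesis
  forces every selected event into \<open>\<C>\<close>. The resampling that first changes this
  involves \<open>i\<close> and brings in entry \<open>(i, 1)\<close>. The run receives
  \<open>shift {1..n} T\<close> because row 0 is already the current state.\<close>

lemma table_run_hit:
  assumes "T \<in> space (tables n M)" "h \<noteq> []" "set h \<subseteq> space \<Omega>" "last h = top_row n T"
    and "T (i, 0) \<notin> D" "last (run (top_row n) shift \<B> f t h (shift {1..n} T)) i \<in> D"
    and i: "i \<in> {1..n}"
    and f: "\<And>h. h \<noteq> [] \<Longrightarrow> set h \<subseteq> space \<Omega> \<Longrightarrow> \<exists>B\<in>\<B>. last h \<in> holds B \<Longrightarrow>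
      f h \<in> \<B> \<and> last h \<in> holds (f h)"
    and "\<And>v B. v \<in> lists \<B> \<Longrightarrow> B \<in> \<B> - \<C> \<Longrightarrow> top_row n (shifts v T) \<in> holds B \<Longrightarrow>
      shifts v T (i, 0) \<in> D"
  shows "\<exists>v\<in>lists \<C>. \<exists>B\<in>\<C>. i \<in> var B \<and> occurs n v T \<and>
    top_row n (shifts v T) \<in> holds B \<and> shifts v T (i, 1) \<in> D"
  using assms(1-6,9)
proof (induction t arbitrary: T h)
  case 0
  then show ?case using i by (simp add: top_row_def)
next
  case (Suc t)
  note null = Suc.prems(7)
  show ?case
  proof (cases "\<exists>B\<in>\<B>. last h \<in> holds B")
    case False
    then show ?thesis using Suc.prems(4-6) i by (simp add: top_row_def)
  next
    case True
    define B where "B = f h"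
    have "B \<in> \<B>" and hB: "top_row n T \<in> holds B"
      using f[OF Suc.prems(2,3) True] Suc.prems(4) by (auto simp: B_def)
    have B: "B \<in> \<C>"
    proof (rule ccontr)
      assume "B \<notin> \<C>"
      then show False using null[of "[]" B] \<open>B \<in> \<B>\<close> hB Suc.prems(5) by simp
    qed
    have V: "var B \<subseteq> {1..n}" using \<open>B \<in> \<B>\<close> by (rule var_subset)
    let ?T = "shift (var B) T"
    have T: "?T \<in> space (tables n M)" using Suc.prems(1) by (rule shift_in_space)
    \<comment> \<open>The next row supplies the columns in \<open>var B\<close> and the others keep
      row 0; this is the top row of the shifted table.\<close>
    have step: "override_on (last h) (top_row n (shift {1..n} T)) (var B) = top_row n ?T"
      unfolding Suc.prems(4) using V
      by (auto simp: fun_eq_iff override_on_def top_row_def shift_def)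
    have run: "last (run (top_row n) shift \<B> f t (h @ [top_row n ?T]) (shift {1..n} ?T)) i \<in> D"
      using Suc.prems(6) True
      by (simp add: step B_def[symmetric] shift_commute[of "var B"] del: One_nat_def)
    show ?thesis
    proof (cases "?T (i, 0) \<in> D")
      \<comment> \<open>This is the first hit: no word precedes it, and \<open>B\<close> itself is
        the root.\<close>
      case True
      then have "i \<in> var B" using Suc.prems(5) shift_outside[of i "var B" T 0] by metis
      moreover have "T (i, 1) \<in> D" using True \<open>i \<in> var B\<close> by (simp add: shift_def)
      ultimately show ?thesis
        using B hB by (intro bexI[of _ "[]"] bexI[of _ B]) simp_all
    next
      case False
      have "\<exists>v\<in>lists \<C>. \<exists>B'\<in>\<C>. i \<in> var B' \<and> occurs n v ?T \<and>
        top_row n (shifts v ?T) \<in> holds B' \<and> shifts v ?T (i, 1) \<in> D"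
      proof (rule Suc.IH[OF T _ _ _ False run])
        show "set (h @ [top_row n ?T]) \<subseteq> space \<Omega>"
          using Suc.prems(3) top_row_in_space[OF T] by simp
        show "shifts v ?T (i, 0) \<in> D"
          if "v \<in> lists \<B>" "B' \<in> \<B> - \<C>" "top_row n (shifts v ?T) \<in> holds B'" for v B'
          using null[of "B # v" B'] that \<open>B \<in> \<B>\<close> by simp
      qed simp_all
      then obtain v B' where "v \<in> lists \<C>" "B' \<in> \<C>" "i \<in> var B'" "occurs n v ?T"
        "top_row n (shifts v ?T) \<in> holds B'" "shifts v ?T (i, 1) \<in> D" by blast
      then show ?thesis using B hB by (intro bexI[of _ "B # v"] bexI[of _ B']) simp_all
    qed
  qed
qed

text \<open>Each \<open>shift\<close> discards what a push puts on top, so a fixed word preserves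
  the law. Null events about row 0 thus stay null after any word.\<close>

lemma emeasure_shifts:
  assumes "v \<in> lists \<B>" "Q \<in> sets (tables n M)"
  shows "{T \<in> space (tables n M). shifts v T \<in> Q} \<in> sets (tables n M) \<and>
    emeasure (tables n M) {T \<in> space (tables n M). shifts v T \<in> Q} = emeasure (tables n M) Q"
  using assms(1)
proof (induction v rule: list.induct)
  case Nil
  have "{T \<in> space (tables n M). T \<in> Q} = Q" using sets.sets_into_space[OF assms(2)] by blast
  then show ?case using assms(2) by simp
next
  case (Cons B v)
  let ?Q = "{T \<in> space (tables n M). shifts v T \<in> Q}"
  have B: "B \<in> \<B>" and Q: "?Q \<in> sets (tables n M)"
    and eq: "emeasure (tables n M) ?Q = emeasure (tables n M) Q" using Cons by auto
  have V: "var B \<subseteq> {1..n}" using B by (rule var_subset)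
  have Y: "{T \<in> space (tables n M). shifts (B # v) T \<in> Q} =
      {T \<in> space (tables n M). shift (var B) T \<in> ?Q}"
    by (auto intro: shift_in_space)
  have "emeasure (tables n M) {T \<in> space (tables n M). shift (var B) T \<in> ?Q} =
    emeasure \<Omega> (space \<Omega>) * emeasure (tables n M) ?Q"
    by (rule emeasure_push[OF V sets.top Q sets_shift[OF Q]]) (use push_in_space[OF V] in auto)
  then show ?case unfolding Y using sets_shift[OF Q] eq by (simp add: \<Omega>.emeasure_space_1)
qed

text \<open>A union bound over roots and the finitely many chains of one length;
  \<open>sum_chains_le_Psi\<close> adds up the weights, uniformly in \<open>L\<close>.\<close>

lemma emeasure_chains_le:
  assumes "shearer_criterion \<Omega> \<C>" "\<C> \<subseteq> \<B>" "set Bs \<subseteq> \<C>" "\<And>j. Q j \<in> sets (tables n M)"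
    and Q: "\<And>j. emeasure (tables n M) (Q j) = ennreal (q j)" "\<And>j. q j \<ge> 0"
  shows "{T \<in> space (tables n M). \<exists>j<length Bs. \<exists>Js\<in>chains \<C> L (var (Bs ! j)).
      consistent n Js T \<and> unwind Js T \<in> Q j} \<in> sets (tables n M) \<and>
    emeasure (tables n M) {T \<in> space (tables n M). \<exists>j<length Bs. \<exists>Js\<in>chains \<C> L (var (Bs ! j)).
      consistent n Js T \<and> unwind Js T \<in> Q j} \<le>
    ennreal (\<Sum>j<length Bs. q j * shearer_Psi \<Omega> \<C> (Bs ! j))"
proof -
  let ?Y = "\<lambda>j Js. {T \<in> space (tables n M). consistent n Js T \<and> unwind Js T \<in> Q j}"
  let ?U = "\<lambda>j. \<Union>Js\<in>chains \<C> L (var (Bs ! j)). ?Y j Js"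
  have eq: "{T \<in> space (tables n M). \<exists>j<length Bs. \<exists>Js\<in>chains \<C> L (var (Bs ! j)).
      consistent n Js T \<and> unwind Js T \<in> Q j} = (\<Union>j\<in>{..<length Bs}. ?U j)" by auto
  have fin: "finite \<C>" using assms(2) finite_family by (rule finite_subset)
  have Y: "?Y j Js \<in> sets (tables n M)"
    "emeasure (tables n M) (?Y j Js) = ennreal ((\<Prod>J\<leftarrow>Js. weight \<Omega> J) * q j)"
    if "Js \<in> chains \<C> L (var (Bs ! j))" for j Js
  proof -
    have "(\<Prod>J\<leftarrow>Js. weight \<Omega> J) \<ge> 0" by (rule prod_list_nonneg) (auto simp: weight_nonneg)
    then show "?Y j Js \<in> sets (tables n M)"
      "emeasure (tables n M) (?Y j Js) = ennreal ((\<Prod>J\<leftarrow>Js. weight \<Omega> J) * q j)"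
      using emeasure_chain[OF assms(2) that assms(4)[of j]] Q[of j] by (simp_all add: ennreal_mult)
  qed
  have U: "?U j \<in> sets (tables n M)" for j
    using finite_chains[OF fin] Y(1) by (intro sets.finite_UN)
  have bound: "emeasure (tables n M) (?U j) \<le> ennreal (q j * shearer_Psi \<Omega> \<C> (Bs ! j))" for j
  proof -
    have nonneg: "(\<Prod>J\<leftarrow>Js. weight \<Omega> J) \<ge> 0" for Js :: "'a event set list"
      by (rule prod_list_nonneg) (auto simp: weight_nonneg)
    have "emeasure (tables n M) (?U j) \<le>
      (\<Sum>Js\<in>chains \<C> L (var (Bs ! j)). emeasure (tables n M) (?Y j Js))"
      using finite_chains[OF fin] Y(1) by (intro emeasure_subadditive_finite) auto
    also have "\<dots> = (\<Sum>Js\<in>chains \<C> L (var (Bs ! j)). ennreal ((\<Prod>J\<leftarrow>Js. weight \<Omega> J) * q j))"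
      by (rule sum.cong[OF refl Y(2)])
    also have "\<dots> = ennreal (\<Sum>Js\<in>chains \<C> L (var (Bs ! j)). (\<Prod>J\<leftarrow>Js. weight \<Omega> J) * q j)"
      using nonneg Q(2) by (intro sum_ennreal) simp
    also have "\<dots> = ennreal (q j * (\<Sum>Js\<in>chains \<C> L (var (Bs ! j)). \<Prod>J\<leftarrow>Js. weight \<Omega> J))"
      by (simp add: sum_distrib_left mult.commute)
    also have "\<dots> \<le> ennreal (q j * shearer_Psi \<Omega> \<C> (Bs ! j))"
      using sum_chains_le_Psi[OF fin assms(1), of L "Bs ! j"] Q(2)
      by (intro ennreal_leI mult_left_mono)
    finally show ?thesis .
  qed
  have Psi: "shearer_Psi \<Omega> \<C> E \<ge> 0" for E
    unfolding shearer_Psi_def using assms(1) by (intro sum_nonneg shearer_mu_nonneg)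
  have "emeasure (tables n M) (\<Union>j\<in>{..<length Bs}. ?U j) \<le>
    (\<Sum>j<length Bs. emeasure (tables n M) (?U j))"
    using U by (intro emeasure_subadditive_finite) auto
  also have "\<dots> \<le> (\<Sum>j<length Bs. ennreal (q j * shearer_Psi \<Omega> \<C> (Bs ! j)))"
    by (intro sum_mono bound)
  also have "\<dots> = ennreal (\<Sum>j<length Bs. q j * shearer_Psi \<Omega> \<C> (Bs ! j))"
    using Q(2) Psi by (intro sum_ennreal) simp
  finally show ?thesis unfolding eq using U by (simp add: sets.finite_UN)
qed

lemma not_relevant_null:
  assumes "B \<in> \<B>" "B \<notin> relevant_to \<Omega> \<B> A" "holds A \<in> sets \<Omega>"
  shows "emeasure \<Omega> (holds B - holds A) = 0"
proof -
  have hB: "holds B \<in> sets \<Omega>" using assms(1) by (rule sets_holds)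
  have sub: "holds B \<subseteq> space \<Omega>" using hB by (rule sets.sets_into_space)
  have "{x \<in> space \<Omega>. x \<in> holds A \<and> x \<in> holds B} = holds B \<inter> holds A"
    "{x \<in> space \<Omega>. x \<in> holds B} = holds B" using sub by auto
  then have "1 \<le> measure \<Omega> (holds B \<inter> holds A) / measure \<Omega> (holds B)"
    using assms(1,2) by (simp add: relevant_to_def cond_prob_def not_less)
  \<comment> \<open>Division by zero yields 0, so the ratio reaches 1 only if \<open>B\<close> has
    positive probability; bad-events of probability 0 belong to \<open>relevant_to\<close>.\<close>
  moreover from this have "measure \<Omega> (holds B) > 0"
    by (metis div_by_0 not_one_le_zero zero_less_measure_iff)
  ultimately have "measure \<Omega> (holds B) \<le> measure \<Omega> (holds B \<inter> holds A)"
    by (simp add: le_divide_eq)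
  moreover have "measure \<Omega> (holds B - holds A) = measure \<Omega> (holds B) - measure \<Omega> (holds B \<inter> holds A)"
    using hB assms(3) by (rule \<Omega>.finite_measure_Diff')
  ultimately have "measure \<Omega> (holds B - holds A) = 0"
    using measure_nonneg[of \<Omega> "holds B - holds A"] by linarith
  then show ?thesis by (simp add: \<Omega>.emeasure_eq_measure)
qed

text \<open>Apart from a null set, a run ending in \<open>G\<close> either starts with
  \<open>A\<close> true, which gives the summand 1, or produces a chain, which is paid for by the
  sum.\<close>

lemma emeasure_table_run_le:
  fixes A and i and D
  defines "A \<equiv> Event {x \<in> space \<Omega>. x i \<in> D} {i}"
  defines "\<C> \<equiv> relevant_to \<Omega> \<B> A"
  assumes crit: "shearer_criterion \<Omega> \<B>" and i: "i \<in> {1..n}" and D: "D \<in> sets (M i)"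
    and Bs: "set Bs = {B \<in> \<C>. i \<in> var B}"
    and sel: "selection_rule \<Omega> \<B> R sel" and r: "r \<in> space R"
    and G: "G \<in> sets \<Omega>" "\<And>x. x \<in> G \<Longrightarrow> x i \<in> D"
  shows "emeasure (tables n M) {T \<in> space (tables n M).
      last (run (top_row n) shift \<B> (sel r) t [top_row n T] (shift {1..n} T)) \<in> G} \<le>
    ennreal (measure \<Omega> (holds A) * (1 + (\<Sum>j<length Bs.
      \<P>(x in \<Omega>. x \<in> holds (Bs ! j) \<and> (\<forall>k<j. x \<notin> holds (Bs ! k))) *
      shearer_Psi \<Omega> \<C> (Bs ! j))))"
proof -
  let ?tab = "tables n M"
  have CB: "\<C> \<subseteq> \<B>" by (auto simp: \<C>_def relevant_to_def)
  have critC: "shearer_criterion \<Omega> \<C>" using crit finite_family CB by (rule shearer_criterion_subset)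
  have A: "holds A \<in> sets \<Omega>"
    using measurable_sets[OF measurable_coord[OF i] D]
    by (simp add: A_def vimage_def Int_def conj_commute)
  define E where "E j = {x \<in> space \<Omega>. x \<in> holds (Bs ! j) \<and> (\<forall>k<j. x \<notin> holds (Bs ! k))}" for j
  have E: "E j \<in> sets \<Omega>" if "j < length Bs" for j
  proof -
    have hBs: "holds (Bs ! k) \<in> sets \<Omega>" if "k < length Bs" for k
      using that Bs CB nth_mem[of k Bs] by (intro sets_holds) auto
    then have "holds (Bs ! j) - (\<Union>k<j. holds (Bs ! k)) \<in> sets \<Omega>"
      using that by (intro sets.Diff[OF hBs sets.finite_UN]) (simp_all add: hBs)
    moreover have "E j = holds (Bs ! j) - (\<Union>k<j. holds (Bs ! k))"
      using sets.sets_into_space[OF hBs[OF that]]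
      by (auto simp: E_def)
    ultimately show ?thesis by simp
  qed
  \<comment> \<open>The demand on the table left by a chain below \<open>Bs ! j\<close>. The default
    \<open>{}\<close> makes \<open>Q j\<close> measurable for every \<open>j\<close>, as
    \<open>emeasure_chains_le\<close> requires.\<close>
  define Q where "Q j = (if j < length Bs
    then {T \<in> space ?tab. top_row n T \<in> E j \<and> T (i, 1) \<in> D} else {})" for j
  define q where "q j = (if j < length Bs then measure \<Omega> (E j) * measure \<Omega> (holds A) else 0)" for j
  have Q: "Q j \<in> sets ?tab" for j
    using E i D by (simp add: Q_def sets_row_entry del: One_nat_def)
  have Qq: "emeasure ?tab (Q j) = ennreal (q j)" for j
    using emeasure_row_then_entry[OF E i D, of j]
    by (simp add: Q_def q_def A_def \<Omega>.emeasure_eq_measure ennreal_mult del: One_nat_def)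
  define hit where "hit L = {T \<in> space ?tab. \<exists>j<length Bs. \<exists>Js\<in>chains \<C> L (var (Bs ! j)).
    consistent n Js T \<and> unwind Js T \<in> Q j}" for L
  let ?\<beta> = "\<Sum>j<length Bs. q j * shearer_Psi \<Omega> \<C> (Bs ! j)"
  have hit: "hit L \<in> sets ?tab" "emeasure ?tab (hit L) \<le> ennreal ?\<beta>" for L
  proof -
    have sub: "set Bs \<subseteq> \<C>" using Bs by blast
    have nonneg: "q j \<ge> 0" for j by (simp add: q_def)
    note le = emeasure_chains_le[where Q = Q and q = q and L = L, OF critC CB sub Q Qq nonneg]
    show "hit L \<in> sets ?tab" "emeasure ?tab (hit L) \<le> ennreal ?\<beta>"
      unfolding hit_def by (rule le[THEN conjunct1], rule le[THEN conjunct2])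
  qed
  have "incseq hit"
  proof (rule incseq_SucI, rule subsetI)
    fix L T assume "T \<in> hit L"
    then obtain j Js where T: "T \<in> space ?tab" "j < length Bs" "Js \<in> chains \<C> L (var (Bs ! j))"
      "consistent n Js T" "unwind Js T \<in> Q j" by (auto simp: hit_def)
    then have "Js @ [{}] \<in> chains \<C> (Suc L) (var (Bs ! j))"
      "consistent n (Js @ [{}]) T" "unwind (Js @ [{}]) T \<in> Q j" by (simp_all only: chains_pad consistent_pad unwind_pad)
    with T(1,2) show "T \<in> hit (Suc L)" unfolding hit_def by blast
  qed
  \<comment> \<open>Different lengths are not added up: padding makes \<open>hit L\<close> increase,
    so the uniform bound passes to the union.\<close>
  then have hits: "emeasure ?tab (\<Union>L. hit L) \<le> ennreal ?\<beta>"
    using hit by (subst SUP_emeasure_incseq[symmetric]) (auto intro: SUP_least)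
  \<comment> \<open>Exceptional tables: after some word an event outside \<open>\<C>\<close> is true
    while \<open>A\<close> is false. Words over a finite family are countable in number, so null
    sets suffice.\<close>
  define N where "N = (\<Union>(v, B)\<in>lists \<B> \<times> (\<B> - \<C>).
    {T \<in> space ?tab. shifts v T \<in> {T \<in> space ?tab. top_row n T \<in> holds B - holds A}})"
  have "N \<in> null_sets ?tab"
    unfolding N_def
  proof (rule null_sets_UN')
    show "countable (lists \<B> \<times> (\<B> - \<C>))"
      using finite_family by (intro countable_SIGMA countable_lists countable_finite) auto
  next
    fix p assume "p \<in> lists \<B> \<times> (\<B> - \<C>)"
    then obtain v B where p: "p = (v, B)" and v: "v \<in> lists \<B>" and B: "B \<in> \<B>" "B \<notin> \<C>"
      by blast
    have d: "holds B - holds A \<in> sets \<Omega>" using sets_holds[OF B(1)] A by simp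
    from emeasure_shifts[OF v sets_top_row[OF d]] emeasure_top_row[OF d]
      not_relevant_null[OF B(1) B(2)[unfolded \<C>_def] A]
    show "(case p of (v, B) \<Rightarrow> {T \<in> space ?tab.
        shifts v T \<in> {T \<in> space ?tab. top_row n T \<in> holds B - holds A}}) \<in> null_sets ?tab"
      unfolding p by (simp add: null_sets_def)
  qed
  let ?A0 = "{T \<in> space ?tab. top_row n T \<in> holds A}"
  let ?Y = "{T \<in> space ?tab. last (run (top_row n) shift \<B> (sel r) t [top_row n T] (shift {1..n} T)) \<in> G}"
  have A0: "?A0 \<in> sets ?tab" "emeasure ?tab ?A0 = emeasure \<Omega> (holds A)"
    using sets_top_row[OF A] emeasure_top_row[OF A] by auto
  have inA: "top_row n T \<in> holds A \<longleftrightarrow> T (i, 0) \<in> D" if "T \<in> space ?tab" for T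
    using top_row_in_space[OF that] i by (simp add: A_def top_row_def)
  \<comment> \<open>Outside \<open>?A0\<close> and \<open>N\<close>, \<open>table_run_hit\<close>
    yields a word, which \<open>minimal_chain\<close> turns into a chain with a suitable
    root.\<close>
  have "?Y \<subseteq> ?A0 \<union> (N \<union> (\<Union>L. hit L))"
  proof (rule subsetI, rule ccontr)
    fix T assume TY: "T \<in> ?Y" and not: "T \<notin> ?A0 \<union> (N \<union> (\<Union>L. hit L))"
    then have T: "T \<in> space ?tab" by simp
    have "\<exists>v\<in>lists \<C>. \<exists>B\<in>\<C>. i \<in> var B \<and> occurs n v T \<and>
      top_row n (shifts v T) \<in> holds B \<and> shifts v T (i, 1) \<in> D"
    proof (rule table_run_hit[where h = "[top_row n T]" and f = "sel r", OF T _ _ _ _ _ i])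
      show "T (i, 0) \<notin> D" using not T inA[OF T] by simp
      show "last (run (top_row n) shift \<B> (sel r) t [top_row n T] (shift {1..n} T)) i \<in> D"
        using TY by (intro G(2)) simp
      show "sel r h \<in> \<B> \<and> last h \<in> holds (sel r h)"
        if "h \<noteq> []" "set h \<subseteq> space \<Omega>" "\<exists>B\<in>\<B>. last h \<in> holds B" for h
        using sel r that by (simp add: selection_rule_def)
      show "shifts v T (i, 0) \<in> D"
        if "v \<in> lists \<B>" "B \<in> \<B> - \<C>" "top_row n (shifts v T) \<in> holds B" for v B
      proof (rule ccontr)
        assume "shifts v T (i, 0) \<notin> D"
        then have "top_row n (shifts v T) \<in> holds B - holds A"
          using that(3) inA[OF shifts_in_space[OF T]] by simp
        then have "T \<in> N" using T shifts_in_space[OF T] that(1,2) unfolding N_def by blast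
        with not show False by simp
      qed
    qed (use top_row_in_space[OF T] in simp_all)
    then obtain v B where vB: "v \<in> lists \<C>" "B \<in> \<C>" "i \<in> var B" "occurs n v T"
      "top_row n (shifts v T) \<in> holds B" "shifts v T (i, 1) \<in> D" by blast
    from minimal_chain[OF CB T Bs this]
    obtain L j Js where j: "j < length Bs" and Js: "Js \<in> chains \<C> L (var (Bs ! j))" "consistent n Js T"
      and u: "top_row n (unwind Js T) \<in> holds (Bs ! j)"
        "\<forall>k<j. top_row n (unwind Js T) \<notin> holds (Bs ! k)" "unwind Js T (i, 1) \<in> D" by blast
    have "unwind Js T \<in> Q j"
      using j u unwind_in_space[OF T] top_row_in_space[OF unwind_in_space[OF T]]
      by (simp add: Q_def E_def)
    then have "T \<in> hit L" using T j Js unfolding hit_def by blast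
    with not show False by blast
  qed
  moreover have NU: "N \<union> (\<Union>L. hit L) \<in> sets ?tab"
    using hit(1) \<open>N \<in> null_sets ?tab\<close> by auto
  ultimately have "emeasure ?tab ?Y \<le> emeasure ?tab (?A0 \<union> (N \<union> (\<Union>L. hit L)))"
    using A0(1) by (intro emeasure_mono) auto
  also have "\<dots> \<le> emeasure ?tab ?A0 + emeasure ?tab (N \<union> (\<Union>L. hit L))"
    using A0(1) NU by (rule emeasure_subadditive)
  also have "emeasure ?tab (N \<union> (\<Union>L. hit L)) = emeasure ?tab (\<Union>L. hit L)"
    using hit(1) \<open>N \<in> null_sets ?tab\<close> by (subst Un_commute, intro emeasure_Un_null_set) auto
  also have "emeasure ?tab ?A0 + \<dots> \<le> ennreal (measure \<Omega> (holds A)) + ennreal ?\<beta>"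
    unfolding A0(2) \<Omega>.emeasure_eq_measure using hits by (rule add_left_mono)
  also have "\<dots> = ennreal (measure \<Omega> (holds A) + ?\<beta>)"
  proof (rule ennreal_plus[symmetric])
    show "0 \<le> ?\<beta>"
      unfolding q_def shearer_Psi_def using critC
      by (intro sum_nonneg mult_nonneg_nonneg shearer_mu_nonneg) simp_all
  qed simp
  also have "measure \<Omega> (holds A) + ?\<beta> = measure \<Omega> (holds A) * (1 + (\<Sum>j<length Bs.
      measure \<Omega> (E j) * shearer_Psi \<Omega> \<C> (Bs ! j)))"
    by (simp add: q_def distrib_left sum_distrib_left mult_ac)
  finally show ?thesis by (simp only: E_def)
qed

end

section \<open>Transfer from tables to the algorithm\<close>

theorem theorem4p4:
  fixes n i :: nat
    and M :: "nat \<Rightarrow> 'a measure"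
    and \<B> :: "'a event set"
    and D :: "'a set"
    and Bs :: "'a event list"
    and R :: "'r measure"
    and sel :: "'r \<Rightarrow> (nat \<Rightarrow> 'a) list \<Rightarrow> 'a event"
  defines "\<Omega> \<equiv> assignments n M"
  defines "A \<equiv> Event {x \<in> space \<Omega>. x i \<in> D} {i}"
  assumes "\<And>k. k \<in> {1..n} \<Longrightarrow> prob_space (M k)"
    and "finite \<B>" and "\<And>B. B \<in> \<B> \<Longrightarrow> is_event n M B"
    and "shearer_criterion \<Omega> \<B>"
    and "i \<in> {1..n}" and "D \<in> sets (M i)"
    and "distinct Bs" and "set Bs = {B \<in> relevant_to \<Omega> \<B> A. i \<in> var B}"
    and "prob_space R" and "selection_rule \<Omega> \<B> R sel"
  shows "mt_prob \<Omega> \<B> R sel A \<le>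
    measure \<Omega> (holds A) *
      (1 + (\<Sum>j<length Bs.
              \<P>(x in \<Omega>. x \<in> holds (Bs ! j) \<and> (\<forall>k<j. x \<notin> holds (Bs ! k))) *
              shearer_Psi \<Omega> (relevant_to \<Omega> \<B> A) (Bs ! j)))"
proof -
  let ?bound = "measure \<Omega> (holds A) *
      (1 + (\<Sum>j<length Bs.
              \<P>(x in \<Omega>. x \<in> holds (Bs ! j) \<and> (\<forall>k<j. x \<notin> holds (Bs ! k))) *
              shearer_Psi \<Omega> (relevant_to \<Omega> \<B> A) (Bs ! j)))"
  interpret bad_events n M \<B> by (intro bad_events.intro variable_setting.intro event_family.intro) fact+
  let ?Y = "PiM UNIV (\<lambda>_ :: nat. assignments n M)"
  interpret tab: sample_source n M \<B> "tables n M" "top_row n" shift push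
    by (rule table_source)
  interpret str: sample_source n M \<B> ?Y "\<lambda>y. y 0" "\<lambda>_ y k. y (Suc k)" "\<lambda>_. case_nat"
    by (rule stream_source)
  interpret R: prob_space R by fact
  interpret Y: prob_space ?Y by (rule str.prob_source)
  interpret RY: pair_prob_space R ?Y ..
  have i: "i \<in> {1..n}" and D: "D \<in> sets (M i)" and sel: "selection_rule (assignments n M) \<B> R sel"
    by (fact assms(7), fact assms(8), fact assms(12)[unfolded \<Omega>_def])
  \<comment> \<open>A state in \<open>G\<close> certifies termination, so the event in
    \<open>mt_prob\<close> becomes a union over times.\<close>
  define G where "G = {x \<in> space (assignments n M). (\<forall>B\<in>\<B>. x \<notin> holds B) \<and> x i \<in> D}"
  have "{x \<in> space (assignments n M). x i \<in> D} \<in> sets (assignments n M)"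
    using measurable_sets[OF measurable_coord[OF i] D] by (simp add: vimage_def Int_def conj_commute)
  then have "{x \<in> space (assignments n M). x i \<in> D} - (\<Union>B\<in>\<B>. holds B) \<in> sets (assignments n M)"
    using finite_family sets_holds by (intro sets.Diff sets.finite_UN)
  moreover have "G = {x \<in> space (assignments n M). x i \<in> D} - (\<Union>B\<in>\<B>. holds B)"
    by (auto simp: G_def)
  ultimately have G: "G \<in> sets (assignments n M)" by simp
  \<comment> \<open>This permits the return from \<open>ennreal\<close> to real numbers at the
    end.\<close>
  have bound_nonneg: "0 \<le> ?bound"
  proof -
    have "shearer_criterion \<Omega> (relevant_to \<Omega> \<B> A)"
    proof (rule shearer_criterion_subset)
      show "relevant_to \<Omega> \<B> A \<subseteq> \<B>" unfolding relevant_to_def by blast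
    qed fact+
    then show ?thesis
      unfolding shearer_Psi_def
      by (intro mult_nonneg_nonneg add_nonneg_nonneg sum_nonneg shearer_mu_nonneg) simp_all
  qed
  \<comment> \<open>With the seed fixed, the stream is exchanged for a table, since both give the
    same integral of \<open>run_prob\<close>; the seed is averaged afterwards.\<close>
  have fixed: "emeasure ?Y {y \<in> space ?Y. last (mt_history \<B> sel r y t) \<in> G} \<le> ennreal ?bound"
    if r: "r \<in> space R" for r t
  proof -
    have "emeasure ?Y {y \<in> space ?Y. last (mt_history \<B> sel r y t) \<in> G} =
      emeasure (tables n M) {T \<in> space (tables n M).
        last (run (top_row n) shift \<B> (sel r) t [top_row n T] (shift {1..n} T)) \<in> G}"
      unfolding mt_history_run str.emeasure_run_start[OF sel r G] tab.emeasure_run_start[OF sel r G] ..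
    also have "\<dots> \<le> ennreal ?bound"
      unfolding A_def \<Omega>_def
      by (rule emeasure_table_run_le[OF _ i D _ sel r G])
        (use assms(6,10) in \<open>simp_all add: G_def A_def \<Omega>_def\<close>)
    finally show ?thesis .
  qed
  let ?E = "\<lambda>t. {q \<in> space (R \<Otimes>\<^sub>M ?Y). last (mt_history \<B> sel (fst q) (snd q) t) \<in> G}"
  have E: "?E t \<in> sets (R \<Otimes>\<^sub>M ?Y)" for t
    unfolding mt_history_run
    using str.sets_run_start[OF sel measurable_fst G measurable_snd, where t = t] by simp
  have E_le: "emeasure (R \<Otimes>\<^sub>M ?Y) (?E t) \<le> ennreal ?bound" for t
  proof -
    have "emeasure (R \<Otimes>\<^sub>M ?Y) (?E t) = (\<integral>\<^sup>+ r. emeasure ?Y (Pair r -` ?E t) \<partial>R)"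
      using E by (rule Y.emeasure_pair_measure_alt)
    also have "\<dots> \<le> (\<integral>\<^sup>+ r. ennreal ?bound \<partial>R)"
    proof (rule nn_integral_mono)
      fix r assume r: "r \<in> space R"
      then have "Pair r -` ?E t = {y \<in> space ?Y. last (mt_history \<B> sel r y t) \<in> G}"
        by (auto simp: space_pair_measure)
      then show "emeasure ?Y (Pair r -` ?E t) \<le> ennreal ?bound" using fixed[OF r] by simp
    qed
    also have "\<dots> = ennreal ?bound" by (simp add: R.emeasure_space_1)
    finally show ?thesis .
  qed
  \<comment> \<open>Once the state is in \<open>G\<close> the history is frozen, so these events
    grow with \<open>t\<close> and continuity from below applies.\<close>
  have "incseq ?E"
  proof (rule incseq_SucI)
    have stop: "mt_history \<B> sel r y (Suc t) = mt_history \<B> sel r y t"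
      if "last (mt_history \<B> sel r y t) \<in> G" for r y t
      using that by (auto simp: G_def)
    show "?E t \<subseteq> ?E (Suc t)" for t
    proof (rule subsetI)
      fix q assume "q \<in> ?E t"
      then show "q \<in> ?E (Suc t)" using stop[of "fst q" "snd q" t] by (simp only: mem_Collect_eq)
    qed
  qed
  have "{(r, y) \<in> space (R \<Otimes>\<^sub>M ?Y). \<exists>t. (\<forall>B\<in>\<B>. mt_state \<B> sel r y t \<notin> holds B) \<and>
      mt_state \<B> sel r y t \<in> holds A} = (\<Union>t. ?E t)"
    by (auto simp: mt_state_def G_def A_def \<Omega>_def) blast
  then have "mt_prob \<Omega> \<B> R sel A = measure (R \<Otimes>\<^sub>M ?Y) (\<Union>t. ?E t)"
    unfolding mt_prob_def \<Omega>_def by (simp add: case_prod_unfold)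
  also have "ennreal \<dots> = emeasure (R \<Otimes>\<^sub>M ?Y) (\<Union>t. ?E t)"
    by (rule RY.emeasure_eq_measure[symmetric])
  also have "\<dots> = (SUP t. emeasure (R \<Otimes>\<^sub>M ?Y) (?E t))"
    using E \<open>incseq ?E\<close> by (intro SUP_emeasure_incseq[symmetric]) auto
  also have "\<dots> \<le> ennreal ?bound" by (intro SUP_least E_le)
  finally show ?thesis using bound_nonneg by simp
qed

end
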